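(* Let $ABC$ be a triangle that is not a right triangle and is not isosceles or equilateral, and let $T$ be a triangle similar to $ABC$. If $ABC$ can be $N$-tiled by $T$, then $N$ is a square.
   Context: An $N$-tiling of a triangle $ABC$ by a triangle $T$ (the tile) is a set of $N$ triangles $T_1,\dots,T_N$, each congruent to $T$ (reflections allowed), with pairwise disjoint interiors, whose union is the closed triangle $ABC$. Tiles need not meet edge-to-edge. *)

theory Defs
  imports "HOL-Analysis.Analysis"
begin

definition closed_triangle :: "(real^2) set \<Rightarrow> bool" where
  "closed_triangle S \<longleftrightarrow> (\<exists>a b c. \<not> collinear {a, b, c} \<and> S = convex hull {a, b, c})"

definition right_triangle :: "real^2 \<Rightarrow> real^2 \<Rightarrow> real^2 \<Rightarrow> bool" where
  "right_triangle a b c \<longleftrightarrow>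
     \<not> collinear {a, b, c} \<and>
     (orthogonal (b - a) (c - a) \<or> orthogonal (a - b) (c - b) \<or> orthogonal (a - c) (b - c))"

(* At least two equal sides, so equilateral triangles are included. *)
definition isosceles_triangle :: "real^2 \<Rightarrow> real^2 \<Rightarrow> real^2 \<Rightarrow> bool" where
  "isosceles_triangle a b c \<longleftrightarrow>
     \<not> collinear {a, b, c} \<and>
     (dist a b = dist a c \<or> dist b a = dist b c \<or> dist c a = dist c b)"

definition similarity_map :: "real \<Rightarrow> (real^2 \<Rightarrow> real^2) \<Rightarrow> bool" where
  "similarity_map r f \<longleftrightarrow> r > 0 \<and> (\<forall>x y. dist (f x) (f y) = r * dist x y)"

(* Orientation-reversing maps are allowed in both notions below. *)
definition similar_figures :: "(real^2) set \<Rightarrow> (real^2) set \<Rightarrow> bool" where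
  "similar_figures S S' \<longleftrightarrow> (\<exists>r f. similarity_map r f \<and> f ` S = S')"

definition congruent_figures :: "(real^2) set \<Rightarrow> (real^2) set \<Rightarrow> bool" where
  "congruent_figures S S' \<longleftrightarrow> (\<exists>f. similarity_map 1 f \<and> f ` S = S')"

definition tiling :: "nat \<Rightarrow> (real^2) set \<Rightarrow> (real^2) set \<Rightarrow> (real^2) set set \<Rightarrow> bool" where
  "tiling N D T \<T> \<longleftrightarrow>
     finite \<T> \<and> card \<T> = N \<and>
     (\<forall>S\<in>\<T>. closed_triangle S \<and> congruent_figures T S) \<and>
     pairwise (\<lambda>S S'. interior S \<inter> interior S' = {}) \<T> \<and>
     \<Union>\<T> = D"

definition can_be_tiled :: "nat \<Rightarrow> (real^2) set \<Rightarrow> (real^2) set \<Rightarrow> bool" where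
  "can_be_tiled N D T \<longleftrightarrow> (\<exists>\<T>. tiling N D T \<T>)"

end

(* Let a < b < c be the sides of ABC, opposite A, B, C, and t the ratio of the tile to ABC, so that
   N t^2 = 1. Each side of ABC is a union of tile edges; this gives a 3x3 matrix M of natural
   numbers with M (a, b, c) = sqrt N (a, b, c). If sqrt N is irrational, - sqrt N is an eigenvalue
   of M too, and by Perron-Frobenius the rows where the ratio of the two eigenvectors is extremal
   form an invariant set of indices on which M has zero diagonal.

   Two facts of geometry exclude such a set. The smallest angle of the tile alone fits into A, so
   side AC is not composed of edges a only. And AB contains an edge c: otherwise each tile along AB
   has its largest angle gamma on AB. As gamma fits neither into A nor into B, two such angles would
   meet at a point inside AB; but gamma is neither beta nor pi / 2, so the remaining angle
   pi - 2 gamma = alpha + beta - gamma is nonzero and smaller than alpha. *)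
theory Submission
  imports Defs
begin

subsection \<open>Nonnegative matrices\<close>

text \<open>Tiles need not meet edge to edge, so edges inside ABC obey no manageable law. Apart from
  the total area, the proof looks only at the sides of ABC, where a tile leaves an edge, a single
  point or nothing, and where finitely many closed convex pieces can be compared direction by
  direction. Angles around a point are never added up: each tile at a point of a side is only known
  to contain a wedge of directions, the wedges of different tiles do not overlap, and this suffices
  to find a gap too narrow for any tile.

  The two facts on AC and AB leave no room for an invariant set. An edge c on AB makes the third
  diagonal entry nonzero, which removes the index 3. AC contains an edge b, which removes 2 by its
  diagonal entry, or an edge c, which would link 2 to the removed index 3. The remaining set {1}
  would make the first row zero, although BC has positive length.\<close>

lemma square_if_sqrt_rational:
  fixes N :: nat and m k :: int
  assumes "sqrt (real N) * of_int m = of_int k" "m \<noteq> 0"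
  shows "\<exists>j::nat. N = j\<^sup>2"
proof -
  have "(sqrt (real N) * of_int m)\<^sup>2 = (of_int k)\<^sup>2"
    using assms by simp
  then have "real_of_int (int N * m\<^sup>2) = real_of_int (k\<^sup>2)"
    by (simp add: power_mult_distrib)
  then have eq: "int N * m\<^sup>2 = k\<^sup>2"
    by (simp only: of_int_eq_iff)
  then have "m\<^sup>2 dvd k\<^sup>2"
    by (metis dvd_triv_right)
  then obtain j where j: "k = m * j"
    by (auto elim: dvdE)
  have "int N = j\<^sup>2"
    using eq assms(2) by (simp add: j power_mult_distrib)
  then have "int N = int ((nat \<bar>j\<bar>)\<^sup>2)"
    by simp
  then show ?thesis
    using of_nat_eq_iff by blast
qed

text \<open>The equality case of the bound \<open>\<bar>y $ i\<bar> \<le> t x $ i\<close> of Perron--Frobenius theory: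
  \<open>I\<close> is the set of rows where the ratio \<open>\<bar>y $ i\<bar> / x $ i\<close> is maximal.\<close>
lemma nonneg_matrix_opposite_eigenvalue:
  fixes M :: "real^'n^'n"
  assumes nonneg: "\<And>i j. 0 \<le> M $ i $ j" and pos: "\<And>i. 0 < x $ i" and "0 < s"
    and x: "M *v x = s *\<^sub>R x" and y: "M *v y = - s *\<^sub>R y" and "y \<noteq> 0"
  obtains I where "I \<noteq> {}" "\<And>i. i \<in> I \<Longrightarrow> M $ i $ i = 0"
    "\<And>i j. i \<in> I \<Longrightarrow> j \<notin> I \<Longrightarrow> M $ i $ j = 0"
proof -
  define q where "q i = \<bar>y $ i\<bar> / x $ i" for i
  define t where "t = Max (range q)"
  have t_ge: "q i \<le> t" for i
    by (simp add: t_def)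
  have y_le: "\<bar>y $ i\<bar> \<le> t * x $ i" for i
    using t_ge[of i] pos[of i] by (simp add: q_def field_simps)
  obtain i0 where i0: "q i0 = t"
    using Max_in[of "range q"] unfolding t_def by fastforce
  have "0 < t"
  proof -
    obtain k where "y $ k \<noteq> 0"
      using \<open>y \<noteq> 0\<close> by (auto simp: vec_eq_iff)
    then have "0 < q k"
      using pos[of k] by (simp add: q_def)
    then show ?thesis
      using t_ge[of k] by linarith
  qed
  define I where "I = {i. \<bar>y $ i\<bar> = t * x $ i}"
  have xr: "(\<Sum>j\<in>UNIV. M $ i $ j * x $ j) = s * x $ i" for i
    using arg_cong[OF x, of "\<lambda>v. v $ i"] by (simp add: matrix_vector_mult_def)
  have yr: "(\<Sum>j\<in>UNIV. M $ i $ j * y $ j) = - s * y $ i" for i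
    using arg_cong[OF y, of "\<lambda>v. v $ i"] by (simp add: matrix_vector_mult_def)
  \<comment> \<open>Adding the equation of \<open>x\<close> with weight \<open>t\<close> and that of
    \<open>y\<close> with the sign of \<open>y $ i\<close> gives the total
    \<open>s * (t * x $ i - \<bar>y $ i\<bar>)\<close>, which vanishes on \<open>I\<close>. All
    summands are nonnegative, so each one vanishes; the bracket is positive for \<open>j = i\<close>
    and for \<open>j\<close> outside \<open>I\<close>.\<close>
  have key: "M $ i $ j * (t * x $ j + sgn (y $ i) * y $ j) = 0" if "i \<in> I" for i j
  proof -
    have "(\<Sum>j\<in>UNIV. M $ i $ j * (t * x $ j + sgn (y $ i) * y $ j)) =
        t * (\<Sum>j\<in>UNIV. M $ i $ j * x $ j) + sgn (y $ i) * (\<Sum>j\<in>UNIV. M $ i $ j * y $ j)"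
      by (simp add: algebra_simps sum.distrib sum_distrib_left)
    also have "\<dots> = s * (t * x $ i - \<bar>y $ i\<bar>)"
      unfolding xr yr by (simp add: abs_sgn algebra_simps)
    also have "\<dots> = 0"
      using that by (simp add: I_def)
    finally have "(\<Sum>j\<in>UNIV. M $ i $ j * (t * x $ j + sgn (y $ i) * y $ j)) = 0" .
    moreover have "0 \<le> M $ i $ j * (t * x $ j + sgn (y $ i) * y $ j)" for j
    proof (rule mult_nonneg_nonneg[OF nonneg])
      have "\<bar>sgn (y $ i) * y $ j\<bar> \<le> \<bar>y $ j\<bar>"
        by (simp add: abs_mult sgn_if)
      then show "0 \<le> t * x $ j + sgn (y $ i) * y $ j"
        using y_le[of j] by linarith
    qed
    ultimately show ?thesis
      by (subst (asm) sum_nonneg_eq_0_iff) auto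
  qed
  show ?thesis
  proof (rule that[of I])
    show "I \<noteq> {}"
      using i0 pos[of i0] by (auto simp: I_def q_def field_simps)
    show "M $ i $ i = 0" if "i \<in> I" for i
    proof -
      have "0 < t * x $ i + sgn (y $ i) * y $ i"
        using \<open>0 < t\<close> pos[of i] by (simp add: add_pos_nonneg sgn_if)
      then show ?thesis
        using key[OF that, of i] by simp
    qed
    show "M $ i $ j = 0" if "i \<in> I" "j \<notin> I" for i j
    proof -
      have "\<bar>sgn (y $ i) * y $ j\<bar> \<le> \<bar>y $ j\<bar>"
        by (simp add: abs_mult sgn_if)
      moreover have "\<bar>y $ j\<bar> < t * x $ j"
        using y_le[of j] that by (auto simp: I_def less_le)
      ultimately have "0 < t * x $ j + sgn (y $ i) * y $ j"
        by linarith
      then show ?thesis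
        using key[OF that(1), of j] by simp
    qed
  qed
qed

text \<open>If \<open>s\<close> is irrational, the characteristic polynomial, having integer coefficients, vanishes
  at \<open>- s\<close> together with \<open>s\<close>.\<close>
lemma opposite_eigenvalue:
  fixes M :: "real^3^3"
  assumes int: "\<And>i j. M $ i $ j \<in> \<int>" and nsq: "\<nexists>k::nat. N = k\<^sup>2"
    and x: "M *v x = sqrt (real N) *\<^sub>R x" "x \<noteq> 0"
  obtains y where "y \<noteq> 0" "M *v y = - sqrt (real N) *\<^sub>R y"
proof -
  define s where "s = sqrt (real N)"
  have s2: "s * s = real N"
    by (simp add: s_def)
  define c2 where "c2 = M$1$1 + M$2$2 + M$3$3"
  define c1 where "c1 = M$1$1 * M$2$2 - M$1$2 * M$2$1 + M$1$1 * M$3$3 - M$1$3 * M$3$1 +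
    M$2$2 * M$3$3 - M$2$3 * M$3$2"
  define c0 where "c0 = det M"
  have mv: "(M - mat z) *v v = M *v v - z *\<^sub>R v" for z v
    by (simp add: vec_eq_iff forall_3 matrix_vector_mult_def mat_def sum_3 algebra_simps)
  have det: "det (M - mat z) = - (z * z * z) + c2 * (z * z) - c1 * z + c0" for z
    by (simp add: det_3 mat_def c2_def c1_def c0_def algebra_simps)
  have ker: "(\<exists>v. v \<noteq> 0 \<and> K *v v = 0) \<longleftrightarrow> det K = 0" for K :: "real^3^3"
    using matrix_left_invertible_ker[of K] invertible_det_nz[of K] invertible_left_inverse[of K]
    by metis
  have "det (M - mat s) = 0"
    using x mv[of s x] ker[of "M - mat s"] by (auto simp: s_def)
  \<comment> \<open>Substituting \<open>s * s = real N\<close> leaves an integer multiple of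
    \<open>s\<close> and an integer. As \<open>s\<close> is irrational, both vanish, and then the
    sign of \<open>s\<close> does not matter.\<close>
  then have root: "s * (real N + c1) = c2 * real N + c0"
    unfolding det by (simp add: s2 algebra_simps)
  have "c1 \<in> \<int>" "c2 \<in> \<int>" "c0 \<in> \<int>"
    using int unfolding c0_def c1_def c2_def det_3 by auto
  then have "real N + c1 \<in> \<int>" "c2 * real N + c0 \<in> \<int>"
    by auto
  then obtain m k where "real N + c1 = of_int m" "c2 * real N + c0 = of_int k"
    by (meson Ints_cases)
  moreover from this have "m = 0"
    using root square_if_sqrt_rational[of N m k] nsq unfolding s_def by metis
  ultimately have "real N + c1 = 0" "c2 * real N + c0 = 0"
    using root by auto
  then have "- (- s * - s * - s) + c2 * (- s * - s) - c1 * (- s) + c0 = 0"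
    using s2 by (simp add: algebra_simps) algebra
  then obtain y where "y \<noteq> 0" "(M - mat (- s)) *v y = 0"
    using ker[of "M - mat (- s)"] unfolding det by auto
  with that show ?thesis
    unfolding mv by (simp add: s_def eq_neg_iff_add_eq_0)
qed

lemma side_matrix_square:
  fixes M :: "real^3^3"
  assumes int: "\<And>i j. M $ i $ j \<in> \<int>" and nonneg: "\<And>i j. 0 \<le> M $ i $ j"
    and x: "M *v x = sqrt (real N) *\<^sub>R x" and pos: "\<And>i. 0 < x $ i"
    and M3: "M $ 3 $ 3 \<noteq> 0" and M2: "M $ 2 $ 2 \<noteq> 0 \<or> M $ 2 $ 3 \<noteq> 0"
  shows "\<exists>k::nat. N = k\<^sup>2"
proof (rule ccontr)
  assume nsq: "\<nexists>k::nat. N = k\<^sup>2"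
  have "N \<noteq> 0"
    using nsq by (metis zero_power2)
  have "x \<noteq> 0"
    using pos[of 1] by auto
  then obtain y where y: "y \<noteq> 0" "M *v y = - sqrt (real N) *\<^sub>R y"
    using opposite_eigenvalue[OF int nsq x] by blast
  obtain I where I: "I \<noteq> {}" "\<And>i. i \<in> I \<Longrightarrow> M $ i $ i = 0"
    "\<And>i j. i \<in> I \<Longrightarrow> j \<notin> I \<Longrightarrow> M $ i $ j = 0"
    using nonneg_matrix_opposite_eigenvalue[OF nonneg pos _ x y(2,1)] \<open>N \<noteq> 0\<close> by auto
  have "3 \<notin> I" "2 \<notin> I"
    using I M2 M3 by metis+
  then have "1 \<in> I"
    using I(1) by (metis exhaust_3 ex_in_conv)
  then have "M $ 1 $ 1 = 0" "M $ 1 $ 2 = 0" "M $ 1 $ 3 = 0"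
    using I \<open>3 \<notin> I\<close> \<open>2 \<notin> I\<close> by auto
  then have "(M *v x) $ 1 = 0"
    by (simp add: matrix_vector_mult_def sum_3)
  then show False
    using x pos[of 1] \<open>N \<noteq> 0\<close> by simp
qed

subsection \<open>Polar coordinates and angles in the plane\<close>

text \<open>This finds a tile along a given direction without describing how tiles are arranged
  around \<open>p\<close>. A closed set that misses \<open>p\<close> misses all nearby points; if
  every set containing \<open>p\<close> contained no further point of the ray, then, the family
  being finite, short pieces of the ray would be uncovered.\<close>

lemma finite_closed_convex_cover_germ:
  fixes p d :: "'a::real_normed_vector"
  assumes "finite F" and cc: "\<And>S. S \<in> F \<Longrightarrow> closed S \<and> convex S"
    and "0 < \<delta>" and cover: "\<And>x. 0 < x \<Longrightarrow> x < \<delta> \<Longrightarrow> p + x *\<^sub>R d \<in> \<Union>F"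
  shows "\<exists>S\<in>F. p \<in> S \<and> (\<exists>\<epsilon>>0. p + \<epsilon> *\<^sub>R d \<in> S)"
proof (rule ccontr)
  assume no: "\<not> ?thesis"
  have "\<forall>\<^sub>F x in at_right 0. p + x *\<^sub>R d \<notin> S" if "S \<in> F" for S
  proof (cases "p \<in> S")
    case True
    then have "p + x *\<^sub>R d \<notin> S" if "0 < x" for x
      using no that \<open>S \<in> F\<close> by blast
    then show ?thesis
      by (auto simp: eventually_at_right_field intro: exI[of _ 1])
  next
    case False
    have "((\<lambda>x. p + x *\<^sub>R d) \<longlongrightarrow> p + 0 *\<^sub>R d) (at_right 0)"
      by (intro tendsto_intros)
    then show ?thesis
      using False cc[OF that] topological_tendstoD[of "\<lambda>x. p + x *\<^sub>R d" p "at_right 0" "- S"]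
      by auto
  qed
  then have "\<forall>\<^sub>F x in at_right 0. \<forall>S\<in>F. p + x *\<^sub>R d \<notin> S"
    using \<open>finite F\<close> by (simp add: eventually_ball_finite_distrib)
  moreover have "\<forall>\<^sub>F x in at_right 0. 0 < x \<and> x < \<delta>"
    using \<open>0 < \<delta>\<close> by (auto simp: eventually_at_right_field)
  ultimately have "\<forall>\<^sub>F x::real in at_right 0. False"
    by eventually_elim (use cover in auto)
  then show False
    by simp
qed

lemma convex_germ:
  fixes p d :: "'a::real_vector"
  assumes "convex S" "p \<in> S" "p + \<epsilon> *\<^sub>R d \<in> S" "0 \<le> x" "x \<le> \<epsilon>"
  shows "p + x *\<^sub>R d \<in> S"
proof (cases "\<epsilon> = 0")
  case True
  then show ?thesis
    using assms by auto
next
  case False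
  have "(1 - x / \<epsilon>) *\<^sub>R p + (x / \<epsilon>) *\<^sub>R (p + \<epsilon> *\<^sub>R d) \<in> S"
    using False assms by (intro convexD) (auto simp: field_simps)
  then show ?thesis
    using False by (simp add: algebra_simps)
qed

definition ang :: "real^2 \<Rightarrow> real^2 \<Rightarrow> real^2 \<Rightarrow> real" where
  "ang V X Y = arccos ((X - V) \<bullet> (Y - V) / (dist V X * dist V Y))"

lemma ang_commute: "ang V X Y = ang V Y X"
  by (simp add: ang_def inner_commute mult.commute)

text \<open>The law of cosines. It makes \<open>ang\<close> a function of three distances, so that
  scaling and reflection of tiles preserve it.\<close>

lemma inner_diff_dist:
  fixes V X Y :: "'a::real_inner"
  shows "(X - V) \<bullet> (Y - V) = ((dist V X)\<^sup>2 + (dist V Y)\<^sup>2 - (dist X Y)\<^sup>2) / 2"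
  using dot_norm_neg[of "X - V" "Y - V"] by (simp add: dist_norm norm_minus_commute)

lemma ang_eq_if_dist_scaled:
  assumes "0 < t" "dist V' X' = t * dist V X" "dist V' Y' = t * dist V Y" "dist X' Y' = t * dist X Y"
  shows "ang V' X' Y' = ang V X Y"
proof -
  have "(X' - V') \<bullet> (Y' - V') = (t * t) * ((X - V) \<bullet> (Y - V))"
    unfolding inner_diff_dist assms by (simp add: power2_eq_square field_simps)
  moreover have "dist V' X' * dist V' Y' = (t * t) * (dist V X * dist V Y)"
    by (simp add: assms)
  ultimately show ?thesis
    unfolding ang_def using \<open>0 < t\<close> mult_divide_mult_cancel_left[of "t * t"] by simp
qed

lemma ang_cos_bound:
  fixes V X Y :: "'a::real_inner"
  shows "\<bar>(X - V) \<bullet> (Y - V) / (dist V X * dist V Y)\<bar> \<le> 1"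
proof -
  have "\<bar>(X - V) \<bullet> (Y - V)\<bar> \<le> dist V X * dist V Y"
    using Cauchy_Schwarz_ineq2[of "X - V" "Y - V"] by (simp add: dist_norm norm_minus_commute)
  then have "\<bar>(X - V) \<bullet> (Y - V)\<bar> / (dist V X * dist V Y) \<le> 1"
    by (intro divide_le_eq_1[THEN iffD2]) (auto simp: less_le)
  then show ?thesis
    by (simp add: abs_mult)
qed

lemma ang_eq_pi_half_imp_orthogonal:
  assumes "ang V X Y = pi / 2" "X \<noteq> V" "Y \<noteq> V"
  shows "orthogonal (X - V) (Y - V)"
proof -
  have "(X - V) \<bullet> (Y - V) / (dist V X * dist V Y) = cos (pi / 2)"
    using assms(1) ang_cos_bound[of X V Y] unfolding ang_def
    by (metis abs_le_iff cos_arccos minus_le_iff)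
  then show ?thesis
    using assms by (simp add: orthogonal_def)
qed

locale frame =
  fixes u n :: "real^2"
  assumes norm_u: "norm u = 1" and norm_n: "norm n = 1" and u_n: "u \<bullet> n = 0"
begin

lemma inner_frame [simp]: "u \<bullet> u = 1" "n \<bullet> n = 1" "u \<bullet> n = 0" "n \<bullet> u = 0"
  using norm_u norm_n u_n by (simp_all add: norm_eq_1 inner_commute)

lemma frame_expand: "v = (v \<bullet> u) *\<^sub>R u + (v \<bullet> n) *\<^sub>R n"
proof -
  have *: "u$1 * u$1 + u$2 * u$2 = 1" "n$1 * n$1 + n$2 * n$2 = 1" "u$1 * n$1 + u$2 * n$2 = 0"
    using inner_frame by (simp_all add: inner_vec_def sum_2)
  then have "u$1 * u$1 + n$1 * n$1 = 1" "u$2 * u$2 + n$2 * n$2 = 1" "u$1 * u$2 + n$1 * n$2 = 0"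
    by algebra+
  then show ?thesis
    unfolding vec_eq_iff forall_2 by (simp add: inner_vec_def sum_2) algebra
qed

definition e :: "real \<Rightarrow> real^2" where
  "e \<theta> = cos \<theta> *\<^sub>R u + sin \<theta> *\<^sub>R n"

lemma e_simps [simp]: "e 0 = u" "e pi = - u" "e (pi / 2) = n"
  by (simp_all add: e_def)

lemma e_inner [simp]: "e \<theta> \<bullet> e \<phi> = cos (\<theta> - \<phi>)"
  by (simp add: e_def inner_add_left inner_add_right cos_diff)

lemma e_inner_n [simp]: "e \<theta> \<bullet> n = sin \<theta>"
  by (simp add: e_def inner_add_left)

lemma norm_e [simp]: "norm (e \<theta>) = 1"
  by (simp add: norm_eq_1)

lemma polar:
  assumes "v \<noteq> 0" "0 \<le> v \<bullet> n"
  obtains r \<theta> where "0 < r" "0 \<le> \<theta>" "\<theta> \<le> pi" "v = r *\<^sub>R e \<theta>"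
proof -
  define r where "r = norm v"
  have "0 < r"
    using assms by (simp add: r_def)
  have "v \<bullet> v = (v \<bullet> u)\<^sup>2 + (v \<bullet> n)\<^sup>2"
    by (subst (2) frame_expand[of v]) (simp add: inner_add_right power2_eq_square)
  then have "(v \<bullet> u)\<^sup>2 + (v \<bullet> n)\<^sup>2 = r\<^sup>2"
    by (simp add: r_def power2_norm_eq_inner)
  then have "((v \<bullet> u) / r)\<^sup>2 + ((v \<bullet> n) / r)\<^sup>2 = r\<^sup>2 / r\<^sup>2"
    by (metis add_divide_distrib power_divide)
  also have "\<dots> = 1"
    using \<open>0 < r\<close> by simp
  finally have "((v \<bullet> u) / r)\<^sup>2 + ((v \<bullet> n) / r)\<^sup>2 = 1" .
  then obtain \<theta> where \<theta>: "0 \<le> \<theta>" "\<theta> \<le> pi" "(v \<bullet> u) / r = cos \<theta>" "(v \<bullet> n) / r = sin \<theta>"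
    using sincos_total_pi[of "(v \<bullet> n) / r" "(v \<bullet> u) / r"] assms \<open>0 < r\<close> by auto
  have "v = r *\<^sub>R e \<theta>"
    using \<open>0 < r\<close> by (subst frame_expand[of v])
      (simp add: e_def scaleR_add_right flip: \<theta>(3,4))
  with \<open>0 < r\<close> \<theta> show ?thesis
    using that by blast
qed

text \<open>Cramer's rule for three directions in the plane. When
  \<open>\<phi> < \<theta> < \<psi> < \<phi> + pi\<close>, all three sines are positive, so the
  middle direction is a positive combination of the outer two.\<close>

lemma e_combination: "sin (\<psi> - \<phi>) *\<^sub>R e \<theta> = sin (\<psi> - \<theta>) *\<^sub>R e \<phi> + sin (\<theta> - \<phi>) *\<^sub>R e \<psi>"
proof -
  have "sin (\<psi> - \<phi>) * cos \<theta> = sin (\<psi> - \<theta>) * cos \<phi> + sin (\<theta> - \<phi>) * cos \<psi>"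
    "sin (\<psi> - \<phi>) * sin \<theta> = sin (\<psi> - \<theta>) * sin \<phi> + sin (\<theta> - \<phi>) * sin \<psi>"
    by (simp_all add: sin_diff algebra_simps)
  then show ?thesis
    by (simp add: e_def scaleR_add_right) (simp add: algebra_simps flip: scaleR_add_left)
qed

lemma ang_polar:
  assumes "0 < r" "0 < r'" "\<phi> \<le> \<psi>" "\<psi> \<le> \<phi> + pi"
  shows "ang p (p + r *\<^sub>R e \<phi>) (p + r' *\<^sub>R e \<psi>) = \<psi> - \<phi>"
proof -
  have "ang p (p + r *\<^sub>R e \<phi>) (p + r' *\<^sub>R e \<psi>) = arccos (cos (\<psi> - \<phi>))"
    using assms by (simp add: ang_def dist_norm) (metis cos_minus minus_diff_eq)
  then show ?thesis
    using assms by (simp add: arccos_cos)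
qed

text \<open>A lower bound on the directions in which \<open>S\<close> leaves \<open>p\<close>, as an
  interval of polar angles; it need not be the whole angle of \<open>S\<close> at \<open>p\<close>.
  Two rays suffice because convexity fills in what lies between them, and a width below
  \<open>pi\<close> keeps them linearly independent.\<close>

definition wedge :: "(real^2) set \<Rightarrow> real^2 \<Rightarrow> real \<Rightarrow> real \<Rightarrow> bool" where
  "wedge S p \<phi> \<psi> \<longleftrightarrow> convex S \<and> p \<in> S \<and> \<phi> < \<psi> \<and> \<psi> < \<phi> + pi \<and>
     (\<exists>r>0. p + r *\<^sub>R e \<phi> \<in> S) \<and> (\<exists>r>0. p + r *\<^sub>R e \<psi> \<in> S)"

lemma wedge_interior:
  assumes "wedge S p \<phi> \<psi>" "\<phi> < \<theta>" "\<theta> < \<psi>"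
  shows "\<exists>\<epsilon>>0. p + \<epsilon> *\<^sub>R e \<theta> \<in> interior S"
proof -
  obtain r1 r2 where r: "r1 > 0" "p + r1 *\<^sub>R e \<phi> \<in> S" "r2 > 0" "p + r2 *\<^sub>R e \<psi> \<in> S"
    and S: "convex S" "p \<in> S" and lt: "\<phi> < \<psi>" "\<psi> < \<phi> + pi"
    using assms(1) unfolding wedge_def by blast
  define x y where "x = p + r1 *\<^sub>R e \<phi>" and "y = p + r2 *\<^sub>R e \<psi>"
  have sins: "sin (\<psi> - \<phi>) > 0" "sin (\<psi> - \<theta>) > 0" "sin (\<theta> - \<phi>) > 0"
    using lt assms(2,3) by (auto intro!: sin_gt_zero)
  have "\<not> collinear {x, p, y}"
  proof
    assume "collinear {x, p, y}"
    then have "collinear {0, x - p, y - p}"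
      by (subst (asm) collinear_3) simp_all
    then have "collinear {0, r1 *\<^sub>R e \<phi>, r2 *\<^sub>R e \<psi>}"
      by (simp only: x_def y_def add_diff_cancel_left')
    moreover have "e \<theta> \<noteq> 0" for \<theta>
      using norm_e[of \<theta>] by force
    ultimately obtain c where "r2 *\<^sub>R e \<psi> = c *\<^sub>R r1 *\<^sub>R e \<phi>"
      using r by (auto simp: collinear_lemma)
    then have "(r2 *\<^sub>R e \<psi>) \<bullet> e (\<phi> + pi / 2) = (c *\<^sub>R r1 *\<^sub>R e \<phi>) \<bullet> e (\<phi> + pi / 2)"
      by simp
    moreover have "cos (\<psi> - (\<phi> + pi / 2)) = sin (\<psi> - \<phi>)"
      by (simp add: sin_cos_eq flip: cos_minus[of "pi / 2 - (\<psi> - \<phi>)"]) (simp add: algebra_simps)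
    ultimately show False
      using r sins by simp
  qed
  then have int: "interior (convex hull {x, p, y}) =
      {v. \<exists>a b c. 0 < a \<and> 0 < b \<and> 0 < c \<and> a + b + c = 1 \<and> a *\<^sub>R x + b *\<^sub>R p + c *\<^sub>R y = v}"
    by (rule interior_convex_hull_3_minimal) simp
  \<comment> \<open>The coordinates of \<open>e \<theta>\<close> with respect to
    \<open>x - p\<close> and \<open>y - p\<close>, read off from
    \<open>e_combination\<close>.\<close>
  define l m where "l = sin (\<psi> - \<theta>) / sin (\<psi> - \<phi>) / r1" and "m = sin (\<theta> - \<phi>) / sin (\<psi> - \<phi>) / r2"
  have lm: "l > 0" "m > 0"
    using sins r by (simp_all add: l_def m_def)
  \<comment> \<open>This scales the two coordinates to the sum 1/2, which leaves the weight 1/2 for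
    \<open>p\<close>, so all three barycentric weights are positive.\<close>
  define \<epsilon> where "\<epsilon> = 1 / (2 * (l + m))"
  have "\<epsilon> * (l + m) = 1 / 2"
    using lm by (simp add: \<epsilon>_def)
  then have \<epsilon>: "\<epsilon> > 0" "\<epsilon> * l + 1 / 2 + \<epsilon> * m = 1"
    using lm unfolding distrib_left by (simp add: \<epsilon>_def, linarith)
  have "e \<theta> = (1 / sin (\<psi> - \<phi>)) *\<^sub>R (sin (\<psi> - \<phi>) *\<^sub>R e \<theta>)"
    using sins by simp
  also have "\<dots> = l *\<^sub>R (x - p) + m *\<^sub>R (y - p)"
    unfolding e_combination[of \<psi> \<phi> \<theta>] using r
    by (simp add: l_def m_def x_def y_def scaleR_add_right)
  finally have "p + \<epsilon> *\<^sub>R e \<theta> = (\<epsilon> * l + 1 / 2 + \<epsilon> * m) *\<^sub>R p + \<epsilon> *\<^sub>R (l *\<^sub>R (x - p) + m *\<^sub>R (y - p))"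
    using \<epsilon>(2) by simp
  also have "\<dots> = (\<epsilon> * l) *\<^sub>R x + (1 / 2) *\<^sub>R p + (\<epsilon> * m) *\<^sub>R y"
    by (simp add: algebra_simps)
  finally have "p + \<epsilon> *\<^sub>R e \<theta> \<in> interior (convex hull {x, p, y})"
    unfolding int using \<epsilon> lm
    by (intro CollectI exI[of _ "\<epsilon> * l"] exI[of _ "1/2"] exI[of _ "\<epsilon> * m"] conjI) simp_all
  moreover have "convex hull {x, p, y} \<subseteq> S"
    using r S by (intro hull_minimal) (auto simp: x_def y_def)
  ultimately show ?thesis
    using \<epsilon> interior_mono by blast
qed

lemma wedges_disjoint:
  assumes S: "wedge S p \<phi> \<psi>" and S': "wedge S' p \<phi>' \<psi>'" and "interior S \<inter> interior S' = {}"
  shows "\<psi> \<le> \<phi>' \<or> \<psi>' \<le> \<phi>"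
proof (rule ccontr)
  assume "\<not> ?thesis"
  then have "max \<phi> \<phi>' < min \<psi> \<psi>'"
    using S S' by (auto simp: wedge_def)
  then obtain \<theta> where "max \<phi> \<phi>' < \<theta>" "\<theta> < min \<psi> \<psi>'"
    using dense by blast
  then obtain a b where ab: "a > 0" "p + a *\<^sub>R e \<theta> \<in> interior S" "b > 0" "p + b *\<^sub>R e \<theta> \<in> interior S'"
    using wedge_interior[OF S, of \<theta>] wedge_interior[OF S', of \<theta>] by auto
  \<comment> \<open>The two interior points lie on one ray from \<open>p\<close> at possibly
    different distances. Moving the farther one towards \<open>p\<close> keeps it interior by
    convexity.\<close>
  have shrink: "p + min a b *\<^sub>R e \<theta> \<in> interior R"
    if "convex R" "p \<in> R" "c > 0" "p + c *\<^sub>R e \<theta> \<in> interior R" "min a b \<le> c" for R c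
  proof -
    have "p - (min a b / c) *\<^sub>R (p - (p + c *\<^sub>R e \<theta>)) \<in> interior R"
      using that ab by (intro mem_interior_convex_shrink) auto
    moreover have "p - (min a b / c) *\<^sub>R (p - (p + c *\<^sub>R e \<theta>)) = p + min a b *\<^sub>R e \<theta>"
      using \<open>c > 0\<close> by simp
    ultimately show ?thesis
      by (simp only:)
  qed
  have "p + min a b *\<^sub>R e \<theta> \<in> interior S \<inter> interior S'"
    using shrink[of S a] shrink[of S' b] ab S S' by (auto simp: wedge_def)
  then show False
    using assms(3) by auto
qed

end

section \<open>Angles of a triangle\<close>

lemma obtain_frame:
  fixes P E F :: "real^2"
  assumes "\<not> collinear {P, E, F}"
  obtains u n where "frame u n" "E = P + dist P E *\<^sub>R u" "0 < (F - P) \<bullet> n"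
proof -
  have "E \<noteq> P"
    using assms by auto
  define u where "u = (E - P) /\<^sub>R dist P E"
  \<comment> \<open>\<open>m\<close> is \<open>u\<close> turned by a right angle. Choosing between
    \<open>m\<close> and \<open>- m\<close> puts \<open>F\<close> on the positive side, so the
    orientation of the triangle no longer matters.\<close>
  define m :: "real^2" where "m = vector [- u$2, u$1]"
  have "norm u = 1"
    using \<open>E \<noteq> P\<close> by (simp add: u_def dist_norm norm_minus_commute)
  then have "u$1 * u$1 + u$2 * u$2 = 1"
    by (simp add: norm_eq_1 inner_vec_def sum_2)
  then have m: "frame u m" "frame u (- m)"
    using \<open>norm u = 1\<close> by (simp_all add: frame_def norm_eq_1 m_def inner_vec_def sum_2)
  have E: "E = P + dist P E *\<^sub>R u"
    using \<open>E \<noteq> P\<close> by (simp add: u_def)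
  have "(F - P) \<bullet> m \<noteq> 0"
  proof
    assume "(F - P) \<bullet> m = 0"
    then have "F - P = ((F - P) \<bullet> u) *\<^sub>R u"
      using frame.frame_expand[OF m(1), of "F - P"] by simp
    also have "\<dots> = (((F - P) \<bullet> u) / dist P E) *\<^sub>R (E - P)"
      using \<open>E \<noteq> P\<close> by (simp add: u_def divide_inverse)
    finally have "collinear {0, E - P, F - P}"
      unfolding collinear_lemma by blast
    then have "collinear {E, P, F}"
      by (subst collinear_3) simp
    then show False
      using assms by (simp add: insert_commute)
  qed
  then show ?thesis
    using that[OF m(1) E] that[OF m(2) E] by (cases "0 < (F - P) \<bullet> m") auto
qed

lemma (in frame) polar_triangle:
  assumes "E = P + dist P E *\<^sub>R u" "0 < (F - P) \<bullet> n" "P \<noteq> E"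
  obtains r where "0 < r" "F = P + r *\<^sub>R e (ang P E F)" "0 < ang P E F" "ang P E F < pi"
proof -
  have "F - P \<noteq> 0"
    using assms by auto
  then obtain r \<theta> where r: "0 < r" "0 \<le> \<theta>" "\<theta> \<le> pi" "F - P = r *\<^sub>R e \<theta>"
    using polar[of "F - P"] assms by auto
  then have "0 < sin \<theta>"
    using assms(2) by (simp add: zero_less_mult_iff)
  then have "0 < \<theta>" "\<theta> < pi"
    using r by (auto simp: less_le)
  have F: "F = P + r *\<^sub>R e \<theta>"
    using r by (metis add_diff_cancel_left' diff_add_cancel add.commute)
  have "ang P E F = \<theta>"
    using ang_polar[of "dist P E" r 0 \<theta> P] assms r F by simp
  then show ?thesis
    using that r F \<open>0 < \<theta>\<close> \<open>\<theta> < pi\<close> by blast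
qed

lemma ang_bounds:
  assumes "\<not> collinear {P, E, F}"
  shows "0 < ang P E F" "ang P E F < pi"
proof -
  obtain u n where "frame u n" "E = P + dist P E *\<^sub>R u" "0 < (F - P) \<bullet> n"
    using obtain_frame[OF assms] .
  moreover have "P \<noteq> E"
    using assms by auto
  ultimately show "0 < ang P E F" "ang P E F < pi"
    using frame.polar_triangle by metis+
qed

lemma ang_mono:
  assumes "\<not> collinear {P, E, F}" "X \<in> convex hull {P, E, F}" "X \<noteq> P"
  shows "ang P E X \<le> ang P E F"
proof -
  have "P \<noteq> E"
    using assms by auto
  obtain u n where "frame u n" and E: "E = P + dist P E *\<^sub>R u" and F: "0 < (F - P) \<bullet> n"
    using obtain_frame[OF assms(1)] .
  interpret frame u n by fact
  define \<alpha> where "\<alpha> = ang P E F"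
  obtain r where r: "0 < r" "F = P + r *\<^sub>R e \<alpha>" "0 < \<alpha>" "\<alpha> < pi"
    using polar_triangle[OF E F \<open>P \<noteq> E\<close>] unfolding \<alpha>_def by blast
  obtain i j k where ijk: "0 \<le> i" "0 \<le> j" "0 \<le> k" "i + j + k = 1" "X = i *\<^sub>R P + j *\<^sub>R E + k *\<^sub>R F"
    using assms(2) by (auto simp: convex_hull_3)
  have "X - P = j *\<^sub>R (E - P) + k *\<^sub>R (F - P) + (i + j + k - 1) *\<^sub>R P"
    unfolding ijk(5) by (simp add: algebra_simps)
  moreover have "E - P = dist P E *\<^sub>R e 0"
    using E by (metis add_diff_cancel_left' e_simps(1))
  moreover have "F - P = r *\<^sub>R e \<alpha>"
    using r(2) by simp
  ultimately have X: "X - P = (j * dist P E) *\<^sub>R e 0 + (k * r) *\<^sub>R e \<alpha>"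
    using ijk(4) by simp
  have "(X - P) \<bullet> n = k * r * sin \<alpha>"
    unfolding X by (simp add: inner_add_left del: e_simps)
  then obtain \<rho> \<theta> where \<rho>: "0 < \<rho>" "0 \<le> \<theta>" "\<theta> \<le> pi" "X - P = \<rho> *\<^sub>R e \<theta>"
    using polar[of "X - P"] \<open>X \<noteq> P\<close> ijk r sin_gt_zero[of \<alpha>] by auto
  \<comment> \<open>\<open>e (\<alpha> - pi / 2)\<close> is normal to the line through
    \<open>P\<close> and \<open>F\<close> and points to the side of \<open>E\<close>. A nonnegative
    product with it says that \<open>X\<close> is not beyond that line.\<close>
  have cs: "cos (\<theta> - (\<alpha> - pi / 2)) = sin (\<alpha> - \<theta>)" for \<theta>
    by (simp add: cos_diff sin_diff cos_add sin_add)
  have "\<rho> * sin (\<alpha> - \<theta>) = (X - P) \<bullet> e (\<alpha> - pi / 2)"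
    unfolding \<rho> by (simp add: cs)
  also have "\<dots> = j * dist P E * sin \<alpha>"
    unfolding X using cs[of 0] cs[of \<alpha>] by (simp add: inner_add_left del: e_simps)
  finally have "0 \<le> \<rho> * sin (\<alpha> - \<theta>)"
    using ijk r sin_gt_zero[of \<alpha>] by simp
  then have "0 \<le> sin (\<alpha> - \<theta>)"
    using \<rho> by (simp add: zero_le_mult_iff)
  then have "\<theta> \<le> \<alpha>"
    using sin_gt_zero[of "\<theta> - \<alpha>"] r \<rho> sin_minus[of "\<alpha> - \<theta>"] by (auto simp: not_less[symmetric])
  moreover have "ang P E X = \<theta>"
  proof -
    have "X = P + \<rho> *\<^sub>R e \<theta>"
      using \<rho>(4) by (metis add_diff_cancel_left' diff_add_cancel add.commute)
    then show ?thesis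
      using ang_polar[of "dist P E" \<rho> 0 \<theta> P] E \<rho> \<open>P \<noteq> E\<close> by simp
  qed
  ultimately show ?thesis
    by (simp add: \<alpha>_def)
qed

text \<open>In one frame with \<open>u\<close> along the side from \<open>P\<close> to
  \<open>E\<close>, the rays from \<open>P\<close> and \<open>E\<close> to \<open>F\<close> have
  directions \<open>\<alpha>\<close> and \<open>\<phi>\<close>. The angles at \<open>E\<close> and
  \<open>F\<close> are then \<open>pi - \<phi>\<close> and \<open>\<phi> - \<alpha>\<close>, and the
  sum telescopes.\<close>

lemma ang_sum:
  assumes "\<not> collinear {P, E, F}"
  shows "ang P E F + ang E P F + ang F P E = pi"
proof -
  have "P \<noteq> E"
    using assms by auto
  obtain u n where "frame u n" and E: "E = P + dist P E *\<^sub>R u" and F: "0 < (F - P) \<bullet> n"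
    using obtain_frame[OF assms(1)] .
  interpret frame u n by fact
  define L where "L = dist P E"
  have "L > 0"
    using \<open>P \<noteq> E\<close> by (simp add: L_def)
  define \<alpha> where "\<alpha> = ang P E F"
  obtain b where b: "0 < b" "F = P + b *\<^sub>R e \<alpha>" "0 < \<alpha>" "\<alpha> < pi"
    using polar_triangle[OF E F \<open>P \<noteq> E\<close>] unfolding \<alpha>_def by blast
  have EP: "E = P + L *\<^sub>R u"
    using E by (simp add: L_def)
  have "(F - E) \<bullet> n = b * sin \<alpha>"
    unfolding EP b(2) by (simp add: inner_diff_left)
  then have "0 < (F - E) \<bullet> n"
    using b sin_gt_zero by simp
  moreover from this have "F - E \<noteq> 0"
    by auto
  ultimately obtain a \<phi> where a: "0 < a" "0 \<le> \<phi>" "\<phi> \<le> pi" "F - E = a *\<^sub>R e \<phi>"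
    using polar[of "F - E"] by auto
  have eq: "b *\<^sub>R e \<alpha> - a *\<^sub>R e \<phi> = L *\<^sub>R e 0"
    unfolding a(4)[symmetric] unfolding EP b(2) by simp
  have cs: "cos (\<theta> - (\<alpha> - pi / 2)) = sin (\<alpha> - \<theta>)" for \<theta>
    by (simp add: cos_diff sin_diff cos_add sin_add)
  \<comment> \<open>The law of sines, obtained by testing with a normal of the line through
    \<open>P\<close> and \<open>F\<close>; it yields \<open>\<alpha> < \<phi>\<close>.\<close>
  have "a * sin (\<phi> - \<alpha>) = L * sin \<alpha>"
    using arg_cong[OF eq, of "\<lambda>v. v \<bullet> e (\<alpha> - pi / 2)"] sin_minus[of "\<alpha> - \<phi>"]
    by (simp add: inner_diff_left cs cs[of 0, simplified] del: e_simps)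
  then have "0 < sin (\<phi> - \<alpha>)"
    using a \<open>L > 0\<close> b sin_gt_zero[of \<alpha>] by (metis zero_less_mult_pos mult_pos_pos)
  then have "\<alpha> < \<phi>"
    using sin_ge_zero[of "\<alpha> - \<phi>"] a b sin_minus[of "\<alpha> - \<phi>"] by (auto simp: not_less[symmetric])
  have FE: "F = E + a *\<^sub>R e \<phi>"
    using a(4) by (metis add_diff_cancel_left' diff_add_cancel add.commute)
  have "ang E F P = pi - \<phi>"
    using ang_polar[of a L \<phi> pi E] a \<open>L > 0\<close> FE EP by simp
  moreover have "ang F P E = \<phi> - \<alpha>"
  proof -
    have opp: "e (\<theta> + pi) = - e \<theta>" for \<theta>
      by (simp add: e_def)
    have "P = F + b *\<^sub>R e (\<alpha> + pi)"
      unfolding opp using b(2) by simp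
    moreover have "E = F + a *\<^sub>R e (\<phi> + pi)"
      unfolding opp using FE by simp
    ultimately have "ang F P E = ang F (F + b *\<^sub>R e (\<alpha> + pi)) (F + a *\<^sub>R e (\<phi> + pi))"
      by simp
    then show ?thesis
      using ang_polar[of b a "\<alpha> + pi" "\<phi> + pi" F] a b \<open>\<alpha> < \<phi>\<close> by simp
  qed
  ultimately show ?thesis
    using ang_commute[of E] by (simp add: \<alpha>_def)
qed

lemma ang_less_if_side_less:
  assumes "\<not> collinear {A, B, C}" "dist B C < dist A C"
  shows "ang A B C < ang B A C"
proof -
  define a b c where "a = dist B C" and "b = dist A C" and "c = dist A B"
  have pos: "a > 0" "b > 0" "c > 0"
    using assms(1) by (auto simp: a_def b_def c_def insert_commute)
  have "c \<noteq> a + b"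
  proof
    assume "c = a + b"
    then have "between (A, B) C"
      by (simp add: between a_def b_def c_def dist_commute)
    then have "collinear {A, C, B}"
      by (rule between_imp_collinear)
    then show False
      using assms(1) by (simp add: insert_commute)
  qed
  then have tri: "c < a + b"
    using dist_triangle[of A B C] by (auto simp: a_def b_def c_def dist_commute)
  \<comment> \<open>The inequality of the cosines, cleared of denominators, factors in this way. The
    strict triangle inequality makes the second factor positive.\<close>
  have "0 < (b - a) * ((a + b)\<^sup>2 - c\<^sup>2)"
    using tri pos assms(2) by (simp add: a_def b_def power_strict_mono)
  then have "(a\<^sup>2 + c\<^sup>2 - b\<^sup>2) * b < (b\<^sup>2 + c\<^sup>2 - a\<^sup>2) * a"
    by (simp add: algebra_simps power2_eq_square)
  then have "(a\<^sup>2 + c\<^sup>2 - b\<^sup>2) * b / (2 * a * b * c) < (b\<^sup>2 + c\<^sup>2 - a\<^sup>2) * a / (2 * a * b * c)"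
    using pos by (intro divide_strict_right_mono) auto
  then have lt: "(a\<^sup>2 + c\<^sup>2 - b\<^sup>2) / 2 / (c * a) < (b\<^sup>2 + c\<^sup>2 - a\<^sup>2) / 2 / (c * b)"
    using pos by (simp add: mult.assoc mult.left_commute mult.commute)
  have A: "ang A B C = arccos ((b\<^sup>2 + c\<^sup>2 - a\<^sup>2) / 2 / (c * b))"
    unfolding ang_def inner_diff_dist by (simp add: a_def b_def c_def add.commute)
  have B: "ang B A C = arccos ((a\<^sup>2 + c\<^sup>2 - b\<^sup>2) / 2 / (c * a))"
    unfolding ang_def inner_diff_dist by (simp add: a_def b_def c_def dist_commute add.commute)
  have "\<bar>(b\<^sup>2 + c\<^sup>2 - a\<^sup>2) / 2 / (c * b)\<bar> \<le> 1" "\<bar>(a\<^sup>2 + c\<^sup>2 - b\<^sup>2) / 2 / (c * a)\<bar> \<le> 1"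
    using ang_cos_bound[of B A C] ang_cos_bound[of A B C] unfolding inner_diff_dist
    by (simp_all add: a_def b_def c_def dist_commute add.commute)
  then show ?thesis
    unfolding A B using lt arccos_less_arccos abs_le_iff minus_le_iff by metis
qed

subsection \<open>Tiles along a side\<close>

text \<open>Equality of sets serves throughout to say that \<open>V\<close>, \<open>W\<close>,
  \<open>X\<close> is a permutation of three distinct vertices; here it is resolved into the six
  cases.\<close>

lemma set3_eq_iff:
  assumes "distinct [P, E, F]"
  shows "{V, W, X} = {P, E, F} \<longleftrightarrow> (V, W, X) \<in> {(P, E, F), (P, F, E), (E, P, F), (E, F, P), (F, P, E), (F, E, P)}"
    (is "?l \<longleftrightarrow> ?r")
proof
  assume ?l
  then have "V \<in> {P, E, F}" "W \<in> {P, E, F}" "X \<in> {P, E, F}" "P \<in> {V, W, X}" "E \<in> {V, W, X}" "F \<in> {V, W, X}"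
    by blast+
  then show ?r
    using assms by auto
qed auto

lemma negligible_if_no_two:
  fixes K :: "real set"
  assumes "\<And>k k'. k \<in> K \<Longrightarrow> k' \<in> K \<Longrightarrow> \<not> k < k'"
  shows "negligible K"
proof -
  have "K \<subseteq> {k}" if "k \<in> K" for k
    using assms that by (metis linorder_neqE_linordered_idom singleton_iff subsetI)
  then show ?thesis
    by (metis equals0I negligible_empty negligible_sing negligible_subset)
qed

text \<open>Shrinking the triangle towards \<open>p\<close> at a vertex with positive barycentric coordinate.\<close>
lemma triangle_dilation:
  fixes P Q R :: "'a::real_vector"
  assumes "p \<in> convex hull {P, Q, R}"
  obtains V W X \<epsilon> where "(V, W, X) \<in> {(P, Q, R), (Q, P, R), (R, P, Q)}" "0 < \<epsilon>"
    "p + \<epsilon> *\<^sub>R (W - V) \<in> convex hull {P, Q, R}" "p + \<epsilon> *\<^sub>R (X - V) \<in> convex hull {P, Q, R}"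
proof -
  obtain i j k where ijk: "0 \<le> i" "0 \<le> j" "0 \<le> k" "i + j + k = 1" "p = i *\<^sub>R P + j *\<^sub>R Q + k *\<^sub>R R"
    using assms by (auto simp: convex_hull_3)
  have mem: "a *\<^sub>R P + b *\<^sub>R Q + c *\<^sub>R R \<in> convex hull {P, Q, R}"
    if "0 \<le> a" "0 \<le> b" "0 \<le> c" "a + b + c = 1" for a b c
    using that by (auto simp: convex_hull_3)
  consider "0 < i" | "0 < j" | "0 < k"
    using ijk by linarith
  then show ?thesis
  proof cases
    case 1
    then show ?thesis
      using that[of P Q R i] mem[of 0 "i + j" k] mem[of 0 j "i + k"] ijk by (simp add: algebra_simps)
  next
    case 2
    then show ?thesis
      using that[of Q P R j] mem[of "i + j" 0 k] mem[of i 0 "j + k"] ijk by (simp add: algebra_simps)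
  next
    case 3
    then show ?thesis
      using that[of R P Q k] mem[of "i + k" j 0] mem[of i "j + k" 0] ijk by (simp add: algebra_simps)
  qed
qed

text \<open>The tile \<open>S\<close> has vertices \<open>h S A\<close>, \<open>h S B\<close>, \<open>h S C\<close>, corresponding to those of the big
  triangle; \<open>t\<close> is the ratio of similarity.\<close>
locale similar_tiling =
  fixes A B C :: "real^2" and \<T> :: "(real^2) set set"
    and h :: "(real^2) set \<Rightarrow> real^2 \<Rightarrow> real^2" and t :: real
  assumes noncollinear: "\<not> collinear {A, B, C}"
    and finite_tiles: "finite \<T>"
    and ratio_pos: "0 < t"
    and tile: "S \<in> \<T> \<Longrightarrow> S = convex hull {h S A, h S B, h S C}"
    and tile_noncollinear: "S \<in> \<T> \<Longrightarrow> \<not> collinear {h S A, h S B, h S C}"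
    and dist_tile: "S \<in> \<T> \<Longrightarrow> V \<in> {A, B, C} \<Longrightarrow> W \<in> {A, B, C} \<Longrightarrow> dist (h S V) (h S W) = t * dist V W"
    and disjoint_interiors: "pairwise (\<lambda>S S'. interior S \<inter> interior S' = {}) \<T>"
    and Union_tiles: "\<Union>\<T> = convex hull {A, B, C}"
begin

lemma tile_permuted:
  assumes "S \<in> \<T>" "{V, W, X} = {A, B, C}"
  shows "S = convex hull {h S V, h S W, h S X}" "\<not> collinear {h S V, h S W, h S X}"
proof -
  have "{h S V, h S W, h S X} = h S ` {V, W, X}"
    by simp
  also have "\<dots> = {h S A, h S B, h S C}"
    unfolding assms by simp
  finally show "S = convex hull {h S V, h S W, h S X}" "\<not> collinear {h S V, h S W, h S X}"
    using tile[OF assms(1)] tile_noncollinear[OF assms(1)] by simp_all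
qed

lemma ang_tile:
  assumes "S \<in> \<T>" "{V, W, X} = {A, B, C}"
  shows "ang (h S V) (h S W) (h S X) = ang V W X"
proof -
  have "V \<in> {A, B, C}" "W \<in> {A, B, C}" "X \<in> {A, B, C}"
    using assms(2) by blast+
  then show ?thesis
    using ratio_pos dist_tile[OF assms(1)] by (intro ang_eq_if_dist_scaled) auto
qed

lemma tile_convex_closed: "S \<in> \<T> \<Longrightarrow> convex S \<and> closed S \<and> bounded S"
  by (metis tile convex_convex_hull compact_convex_hull compact_imp_closed compact_imp_bounded
      finite_imp_compact finite.emptyI finite_insert)

lemma vertex_in_tile: "S \<in> \<T> \<Longrightarrow> V \<in> {A, B, C} \<Longrightarrow> h S V \<in> S"
  by (subst tile) (auto intro: hull_inc)

end

text \<open>One setting for all three sides and both directions of travel: the side runs from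
  \<open>P\<close> to \<open>E\<close>, \<open>F\<close> is opposite, and \<open>n\<close> points
  inwards. The labels \<open>A\<close>, \<open>B\<close>, \<open>C\<close> of the tiling stay fixed,
  while \<open>perm\<close> allows any roles for them.\<close>

locale tiling_side = similar_tiling A B C \<T> h t + frame u n
  for A B C \<T> h t u n +
  fixes P E F :: "real^2"
  assumes perm: "{P, E, F} = {A, B, C}"
    and E_eq: "E = P + dist P E *\<^sub>R u"
    and F_pos: "0 < (F - P) \<bullet> n"
begin

abbreviation "D \<equiv> convex hull {P, E, F}"
abbreviation "L \<equiv> dist P E"
abbreviation "pos x \<equiv> (x - P) \<bullet> u"
abbreviation "height x \<equiv> (x - P) \<bullet> n"
abbreviation "on S V \<equiv> height (h S V) = 0"

lemma PEF_noncollinear: "\<not> collinear {P, E, F}"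
  using noncollinear perm by simp

lemma distinct: "distinct [P, E, F]"
  using PEF_noncollinear by (auto simp: insert_commute)

lemma L_pos: "0 < L"
  using distinct by simp

lemma permE:
  assumes "{V, W, X} = {A, B, C}"
  shows "(V, W, X) \<in> {(P, E, F), (P, F, E), (E, P, F), (E, F, P), (F, P, E), (F, E, P)}"
  using assms set3_eq_iff[OF distinct] perm by metis

lemma mem_vertices: "P \<in> {A, B, C}" "E \<in> {A, B, C}" "F \<in> {A, B, C}"
  using perm by blast+

lemma tile_subset: "S \<in> \<T> \<Longrightarrow> S \<subseteq> D"
  using Union_tiles perm by auto

lemma point_eq_if_height_0: "height x = 0 \<Longrightarrow> x = P + pos x *\<^sub>R u"
  using frame_expand[of "x - P"] by (simp add: algebra_simps)

lemma line_diff: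
  assumes "height x = 0" "height y = 0"
  shows "y - x = (pos y - pos x) *\<^sub>R u"
  using point_eq_if_height_0[of x] point_eq_if_height_0[of y] assms
  by (metis add_diff_cancel_left scaleR_left_diff_distrib)

lemma line_shift:
  assumes "height x = 0" "height y = 0"
  shows "y = x + (pos y - pos x) *\<^sub>R u"
  unfolding line_diff[OF assms, symmetric] by simp

lemma D_point:
  assumes "x \<in> D"
  shows "0 \<le> height x" "height x = 0 \<Longrightarrow> 0 \<le> pos x \<and> pos x \<le> L"
proof -
  obtain i j k where ijk: "0 \<le> i" "0 \<le> j" "0 \<le> k" "i + j + k = 1" "x = i *\<^sub>R P + j *\<^sub>R E + k *\<^sub>R F"
    using assms by (auto simp: convex_hull_3)
  have "x - P = j *\<^sub>R (E - P) + k *\<^sub>R (F - P) + (i + j + k - 1) *\<^sub>R P"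
    unfolding ijk(5) by (simp add: algebra_simps)
  moreover have "E - P = L *\<^sub>R u"
    using E_eq by (metis add_diff_cancel_left')
  ultimately have x: "x - P = (j * L) *\<^sub>R u + k *\<^sub>R (F - P)"
    using ijk(4) by simp
  have ht: "height x = k * height F"
    unfolding x by (simp add: inner_add_left)
  then show "0 \<le> height x"
    using ijk F_pos by simp
  assume "height x = 0"
  then have "k = 0"
    using ht F_pos by simp
  then have "pos x = j * L"
    unfolding x by simp
  moreover have "j * L \<le> 1 * L"
    using ijk by (intro mult_right_mono) auto
  ultimately show "0 \<le> pos x \<and> pos x \<le> L"
    using ijk by simp
qed

lemma side_in_D: "0 \<le> k \<Longrightarrow> k \<le> L \<Longrightarrow> P + k *\<^sub>R u \<in> D"
  using convex_germ[of D P L u k] E_eq by (simp add: hull_inc)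

lemma tile_point:
  assumes "S \<in> \<T>" "x \<in> S"
  shows "0 \<le> height x" "height x = 0 \<Longrightarrow> 0 \<le> pos x \<and> pos x \<le> L"
  using assms tile_subset D_point by blast+

lemma vertex_point:
  assumes "S \<in> \<T>" "V \<in> {A, B, C}"
  shows "0 \<le> height (h S V)" "on S V \<Longrightarrow> 0 \<le> pos (h S V) \<and> pos (h S V) \<le> L"
  using tile_point[OF assms(1) vertex_in_tile[OF assms]] by blast+

text \<open>No vertex of a tile lies below the side, so a convex combination at height zero gives no
  weight to a vertex off the side.\<close>

lemma trace_in_edge:
  assumes "S \<in> \<T>" "{V, W, X} = {A, B, C}" "x \<in> S" "height x = 0" "\<not> on S X"
  obtains i j where "0 \<le> i" "0 \<le> j" "i + j = 1" "x = i *\<^sub>R h S V + j *\<^sub>R h S W"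
    "\<not> on S W \<Longrightarrow> j = 0"
proof -
  have mem: "V \<in> {A, B, C}" "W \<in> {A, B, C}" "X \<in> {A, B, C}"
    using assms(2) by blast+
  obtain i j k where ijk: "0 \<le> i" "0 \<le> j" "0 \<le> k" "i + j + k = 1"
    "x = i *\<^sub>R h S V + j *\<^sub>R h S W + k *\<^sub>R h S X"
    using assms(3) tile_permuted(1)[OF assms(1,2)] convex_hull_3[of "h S V" "h S W" "h S X"] by blast
  have "x - P = i *\<^sub>R (h S V - P) + j *\<^sub>R (h S W - P) + k *\<^sub>R (h S X - P) + (i + j + k - 1) *\<^sub>R P"
    unfolding ijk(5) by (simp add: algebra_simps)
  then have "height x = i * height (h S V) + j * height (h S W) + k * height (h S X)"
    using ijk(4) by (simp add: inner_add_left)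
  moreover have "0 \<le> i * height (h S V)" "0 \<le> j * height (h S W)" "0 \<le> k * height (h S X)"
    using ijk vertex_point(1)[OF assms(1)] mem by (auto intro!: mult_nonneg_nonneg)
  ultimately have "k * height (h S X) = 0" "j * height (h S W) = 0"
    using assms(4) by linarith+
  then have "k = 0" "\<not> on S W \<Longrightarrow> j = 0"
    using assms(5) by auto
  then show ?thesis
    using that[of i j] ijk by simp
qed

lemma third_vertex_off:
  assumes "S \<in> \<T>" "{V, W, X} = {A, B, C}" "on S V" "on S W"
  shows "\<not> on S X"
proof
  assume "on S X"
  have "collinear {h S V, h S W, h S X}"
    unfolding collinear_def
  proof (intro exI[of _ u] ballI)
    fix x y
    assume "x \<in> {h S V, h S W, h S X}" "y \<in> {h S V, h S W, h S X}"
    then have "height x = 0" "height y = 0"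
      using assms \<open>on S X\<close> by auto
    then have "x - y = (pos x - pos y) *\<^sub>R u"
      using line_diff by blast
    then show "\<exists>c. x - y = c *\<^sub>R u"
      by blast
  qed
  then show False
    using tile_permuted(2)[OF assms(1,2)] by simp
qed

lemma dist_on_line:
  assumes "height x = 0" "height y = 0"
  shows "dist x y = \<bar>pos x - pos y\<bar>"
  using line_diff[OF assms(2,1)] by (simp add: dist_norm norm_u)

lemma trace_eq_segment:
  assumes "S \<in> \<T>" "{V, W, X} = {A, B, C}" "on S V" "on S W"
  shows "{k. P + k *\<^sub>R u \<in> S} = closed_segment (pos (h S V)) (pos (h S W))"
proof -
  have hV: "h S V = P + pos (h S V) *\<^sub>R u" and hW: "h S W = P + pos (h S W) *\<^sub>R u"
    using assms point_eq_if_height_0 by auto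
  have mem: "V \<in> {A, B, C}" "W \<in> {A, B, C}"
    using assms(2) by blast+
  show ?thesis
  proof (intro set_eqI iffI; clarify)
    fix k
    assume "P + k *\<^sub>R u \<in> S"
    moreover have "height (P + k *\<^sub>R u) = 0"
      by simp
    ultimately obtain i j where ij: "0 \<le> i" "0 \<le> j" "i + j = 1" "P + k *\<^sub>R u = i *\<^sub>R h S V + j *\<^sub>R h S W"
      using trace_in_edge[OF assms(1,2) _ _ third_vertex_off[OF assms]] by metis
    have "P + k *\<^sub>R u - P = i *\<^sub>R (h S V - P) + j *\<^sub>R (h S W - P) + (i + j - 1) *\<^sub>R P"
      unfolding ij(4) by (simp add: algebra_simps)
    then have "(P + k *\<^sub>R u - P) \<bullet> u = i * pos (h S V) + j * pos (h S W)"
      using ij(3) by (simp add: inner_add_left del: add_diff_cancel_left')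
    moreover have "i = 1 - j"
      using ij(3) by simp
    ultimately have "k = (1 - j) *\<^sub>R pos (h S V) + j *\<^sub>R pos (h S W)"
      by simp
    then show "k \<in> closed_segment (pos (h S V)) (pos (h S W))"
      using ij by (auto simp: closed_segment_def)
  next
    fix k
    assume "k \<in> closed_segment (pos (h S V)) (pos (h S W))"
    then obtain j where j: "0 \<le> j" "j \<le> 1" "k = (1 - j) * pos (h S V) + j * pos (h S W)"
      by (auto simp: closed_segment_def)
    have "(1 - j) *\<^sub>R h S V + j *\<^sub>R h S W \<in> S"
      using j tile_convex_closed[OF assms(1)] vertex_in_tile[OF assms(1)] mem by (intro convexD) auto
    also have "(1 - j) *\<^sub>R h S V + j *\<^sub>R h S W = P + k *\<^sub>R u"
      by (subst hV, subst hW) (simp add: j algebra_simps)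
    finally show "P + k *\<^sub>R u \<in> S" .
  qed
qed

text \<open>With at most one vertex on the side, the tile would meet it in at most that vertex,
  which two distinct points exclude. The two vertices are then named in the direction of
  \<open>u\<close>.\<close>

lemma two_vertices_on:
  assumes "S \<in> \<T>" "P + k *\<^sub>R u \<in> S" "P + k' *\<^sub>R u \<in> S" "k < k'"
  obtains V W X where "{V, W, X} = {A, B, C}" "on S V" "on S W" "pos (h S V) \<le> k" "k' \<le> pos (h S W)"
proof -
  have only: "x = h S V"
    if VWX: "{V, W, X} = {A, B, C}" and W: "\<not> on S W" and X: "\<not> on S X"
      and x: "x \<in> S" "height x = 0" for V W X x
  proof -
    obtain i j where "i + j = 1" "x = i *\<^sub>R h S V + j *\<^sub>R h S W" "j = 0"
      using trace_in_edge[OF assms(1) VWX x X] W by metis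
    then show ?thesis
      by simp
  qed
  have h0: "height (P + k *\<^sub>R u) = 0" for k
    by simp
  have sub: "P + k *\<^sub>R u = P + k' *\<^sub>R u"
    if "{V, W, X} = {A, B, C}" "\<not> on S W" "\<not> on S X" for V W X
    using only[OF that assms(2) h0] only[OF that assms(3) h0] by (rule trans[OF _ sym])
  have ne: "P + k *\<^sub>R u \<noteq> P + k' *\<^sub>R u"
    using assms(4) norm_u by auto
  obtain V W X where VWX: "{V, W, X} = {A, B, C}" "on S V" "on S W"
  proof -
    have perms: "{B, C, A} = {A, B, C}" "{C, A, B} = {A, B, C}"
      by blast+
    consider "on S A" "on S B" | "on S B" "on S C" | "on S C" "on S A"
      using sub[OF refl] sub[OF perms(1)] sub[OF perms(2)] ne by blast
    then show thesis
      using that[OF refl] that[OF perms(1)] that[OF perms(2)] by cases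
  qed
  have "k \<in> {k. P + k *\<^sub>R u \<in> S}" "k' \<in> {k. P + k *\<^sub>R u \<in> S}"
    using assms by auto
  then have seg: "k \<in> closed_segment (pos (h S V)) (pos (h S W))" "k' \<in> closed_segment (pos (h S V)) (pos (h S W))"
    unfolding trace_eq_segment[OF assms(1) VWX] .
  show ?thesis
  proof (cases "pos (h S V) \<le> pos (h S W)")
    case True
    then show ?thesis
      using that[OF VWX] seg by (simp add: closed_segment_eq_real_ivl)
  next
    case False
    have "{W, V, X} = {A, B, C}"
      using VWX(1) by blast
    with False show ?thesis
      using that[of W V X] VWX seg by (simp add: closed_segment_eq_real_ivl)
  qed
qed

lemma vertex_above:
  assumes "S \<in> \<T>"
  obtains X where "X \<in> {A, B, C}" "0 < height (h S X)"
  using third_vertex_off[OF assms, of A B C] vertex_point(1)[OF assms] less_le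
  by (metis insertCI)

text \<open>At the midpoint of the common stretch each tile contains a wedge that starts in
  direction \<open>0\<close> and is opened by a vertex above the side. Two such wedges overlap, and
  with them the interiors.\<close>

lemma tile_eq_if_overlap_on_side:
  assumes "S \<in> \<T>" "P + k *\<^sub>R u \<in> S" "P + k' *\<^sub>R u \<in> S"
    and "S' \<in> \<T>" "P + k *\<^sub>R u \<in> S'" "P + k' *\<^sub>R u \<in> S'" and "k < k'"
  shows "S = S'"
proof (rule ccontr)
  assume "S \<noteq> S'"
  define p where "p = P + ((k + k') / 2) *\<^sub>R u"
  have *: "\<exists>\<theta>>0. wedge R p 0 \<theta>" if "R \<in> \<T>" "P + k *\<^sub>R u \<in> R" "P + k' *\<^sub>R u \<in> R" for R
  proof -
    have "convex R"
      using tile_convex_closed that by blast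
    have add: "P + a *\<^sub>R u + b *\<^sub>R u = P + (a + b) *\<^sub>R u" for a b
      by (simp add: scaleR_left_distrib)
    have k': "P + k' *\<^sub>R u = p + ((k' - k) / 2) *\<^sub>R u"
      unfolding p_def add by (rule arg_cong[of _ _ "\<lambda>k. P + k *\<^sub>R u"]) (simp add: field_simps)
    have "P + k *\<^sub>R u + ((k' - k) / 2) *\<^sub>R u \<in> R"
      using that \<open>convex R\<close> \<open>k < k'\<close> convex_germ[of R "P + k *\<^sub>R u" "k' - k" u "(k' - k) / 2"]
      by (simp add: add)
    also have "P + k *\<^sub>R u + ((k' - k) / 2) *\<^sub>R u = p"
      unfolding p_def add by (rule arg_cong[of _ _ "\<lambda>k. P + k *\<^sub>R u"]) (simp add: field_simps)
    finally have "p \<in> R" .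
    obtain X where X: "X \<in> {A, B, C}" "0 < height (h R X)"
      using vertex_above[OF \<open>R \<in> \<T>\<close>] .
    have "(h R X - p) \<bullet> n = height (h R X)"
      by (simp add: p_def inner_diff_left inner_add_left)
    then obtain r \<theta> where r: "0 < r" "0 \<le> \<theta>" "\<theta> \<le> pi" "h R X - p = r *\<^sub>R e \<theta>"
      using polar[of "h R X - p"] X(2) by (metis inner_zero_left less_imp_le less_irrefl)
    then have "0 < r * sin \<theta>"
      using X(2) \<open>(h R X - p) \<bullet> n = height (h R X)\<close> by simp
    then have "0 < sin \<theta>"
      using r(1) zero_less_mult_pos by blast
    then have "0 < \<theta>" "\<theta> < pi"
      using r by (auto simp: less_le)
    have "h R X = p + r *\<^sub>R e \<theta>"
      using r(4) by (metis add_diff_cancel_left' diff_add_cancel add.commute)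
    then have "\<exists>r>0. p + r *\<^sub>R e \<theta> \<in> R"
      using r(1) vertex_in_tile[OF \<open>R \<in> \<T>\<close> X(1)] by auto
    moreover have "\<exists>r>0. p + r *\<^sub>R e 0 \<in> R"
      using k' that(3) \<open>k < k'\<close> by (intro exI[of _ "(k' - k) / 2"]) simp
    ultimately have "wedge R p 0 \<theta>"
      unfolding wedge_def using \<open>convex R\<close> \<open>p \<in> R\<close> \<open>0 < \<theta>\<close> \<open>\<theta> < pi\<close> by simp
    with \<open>0 < \<theta>\<close> show ?thesis
      by blast
  qed
  obtain \<theta> \<theta>' where "0 < \<theta>" "wedge S p 0 \<theta>" "0 < \<theta>'" "wedge S' p 0 \<theta>'"
    using *[of S] *[of S'] assms by auto
  moreover have "interior S \<inter> interior S' = {}"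
    using disjoint_interiors assms \<open>S \<noteq> S'\<close> by (auto simp: pairwise_def)
  ultimately show False
    using wedges_disjoint by fastforce
qed

section \<open>Lengths of tile edges along a side\<close>

lemma trace_measure_edge:
  assumes "S \<in> \<T>" "{V, W, X} = {A, B, C}" "on S V" "on S W"
  shows "measure lebesgue {k. P + k *\<^sub>R u \<in> S} = t * dist V W"
proof -
  have "V \<in> {A, B, C}" "W \<in> {A, B, C}"
    using assms(2) by blast+
  then have "t * dist V W = \<bar>pos (h S V) - pos (h S W)\<bar>"
    using dist_on_line[OF assms(3,4)] dist_tile[OF assms(1)] by metis
  then show ?thesis
    unfolding trace_eq_segment[OF assms] by (simp add: closed_segment_eq_real_ivl)
qed

lemma trace_lmeasurable:
  assumes "S \<in> \<T>"
  shows "{k. P + k *\<^sub>R u \<in> S} \<in> lmeasurable"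
proof (rule lmeasurable_compact)
  have "closed {k. P + k *\<^sub>R u \<in> S}"
    using closed_vimage[of S "\<lambda>k. P + k *\<^sub>R u"] tile_convex_closed[OF assms]
    by (simp add: vimage_def continuous_intros)
  moreover have "{k. P + k *\<^sub>R u \<in> S} \<subseteq> {0..L}"
    using tile_point(2)[OF assms] by force
  ultimately show "compact {k. P + k *\<^sub>R u \<in> S}"
    by (meson bounded_closed_interval bounded_subset compact_eq_bounded_closed)
qed

text \<open>At most one term is nonzero, as a tile has at most one edge on the side. Written as a
  sum of three terms, the measure can be added over all tiles separately for each kind of
  edge.\<close>

lemma trace_measure:
  assumes "S \<in> \<T>" "{V, W, X} = {A, B, C}"
  shows "measure lebesgue {k. P + k *\<^sub>R u \<in> S} =
    t * ((if on S V \<and> on S W then dist V W else 0) + (if on S W \<and> on S X then dist W X else 0) +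
         (if on S X \<and> on S V then dist X V else 0))"
proof -
  have perms: "{V, W, X} = {A, B, C}" "{W, X, V} = {A, B, C}" "{X, V, W} = {A, B, C}"
    using assms(2) by blast+
  consider "on S V" "on S W" | "on S W" "on S X" | "on S X" "on S V" |
    "\<not> (on S V \<and> on S W)" "\<not> (on S W \<and> on S X)" "\<not> (on S X \<and> on S V)"
    by blast
  then show ?thesis
  proof cases
    case 1
    then show ?thesis
      using third_vertex_off[OF assms(1) perms(1)] trace_measure_edge[OF assms(1) perms(1)] by simp
  next
    case 2
    then show ?thesis
      using third_vertex_off[OF assms(1) perms(2)] trace_measure_edge[OF assms(1) perms(2)] by simp
  next
    case 3
    then show ?thesis
      using third_vertex_off[OF assms(1) perms(3)] trace_measure_edge[OF assms(1) perms(3)] by simp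
  next
    case 4
    have "negligible {k. P + k *\<^sub>R u \<in> S}"
    proof (rule negligible_if_no_two; clarify)
      fix k k' :: real
      assume "P + k *\<^sub>R u \<in> S" "P + k' *\<^sub>R u \<in> S" "k < k'"
      then obtain V' W' X' where V': "{V', W', X'} = {A, B, C}" "on S V'" "on S W'"
        using two_vertices_on[OF assms(1)] by metis
      have "distinct [V, W, X]"
        using permE[OF assms(2)] distinct by auto
      then show False
        using set3_eq_iff[of V W X V' W' X'] V' assms(2) 4 by auto
    qed
    then show ?thesis
      using 4 by (auto simp: negligible_imp_measure0)
  qed
qed

definition edge_count :: "real^2 \<Rightarrow> real^2 \<Rightarrow> nat" where
  "edge_count V W = card {S \<in> \<T>. on S V \<and> on S W}"

lemma edge_count_commute: "edge_count V W = edge_count W V"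
  by (simp add: edge_count_def conj_commute)

text \<open>Lebesgue measure replaces a listing of the edges in order: the traces of the tiles cover
  the side, and two of them share at most a point. This is one row of the eigenvector
  equation.\<close>

lemma side_length:
  assumes "{V, W, X} = {A, B, C}"
  shows "L = t * (edge_count V W * dist V W + edge_count W X * dist W X + edge_count X V * dist X V)"
proof -
  define I where "I S = {k. P + k *\<^sub>R u \<in> S}" for S
  have "(\<Union>S\<in>\<T>. I S) = {0..L}"
  proof (intro set_eqI iffI)
    fix k
    assume "k \<in> (\<Union>S\<in>\<T>. I S)"
    then obtain S where "S \<in> \<T>" "P + k *\<^sub>R u \<in> S"
      by (auto simp: I_def)
    then show "k \<in> {0..L}"
      using tile_point(2) by force
  next
    fix k
    assume "k \<in> {0..L}"
    then have "P + k *\<^sub>R u \<in> \<Union>\<T>"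
      using side_in_D Union_tiles perm by simp
    then show "k \<in> (\<Union>S\<in>\<T>. I S)"
      by (auto simp: I_def)
  qed
  moreover have "measure lebesgue (\<Union>S\<in>\<T>. I S) = (\<Sum>S\<in>\<T>. measure lebesgue (I S))"
  proof (rule measure_negligible_finite_Union_image[OF finite_tiles])
    show "I S \<in> lmeasurable" if "S \<in> \<T>" for S
      unfolding I_def by (rule trace_lmeasurable[OF that])
    show "pairwise (\<lambda>S S'. negligible (I S \<inter> I S')) \<T>"
    proof (rule pairwiseI, rule negligible_if_no_two)
      fix S S' k k'
      assume "S \<in> \<T>" "S' \<in> \<T>" "S \<noteq> S'" "k \<in> I S \<inter> I S'" "k' \<in> I S \<inter> I S'"
      then show "\<not> k < k'"
        using tile_eq_if_overlap_on_side[of S k k' S'] by (auto simp: I_def)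
    qed
  qed
  moreover have count: "(\<Sum>S\<in>\<T>. if Q S then d else 0) = real (card {S \<in> \<T>. Q S}) * d" for Q d
    by (simp add: finite_tiles sum.inter_filter[symmetric])
  ultimately have "L = (\<Sum>S\<in>\<T>. measure lebesgue (I S))"
    using L_pos by simp
  also have "\<dots> = (\<Sum>S\<in>\<T>. t * ((if on S V \<and> on S W then dist V W else 0) +
      (if on S W \<and> on S X then dist W X else 0) + (if on S X \<and> on S V then dist X V else 0)))"
    unfolding I_def using trace_measure[OF _ assms] by (intro sum.cong) auto
  also have "\<dots> = t * ((\<Sum>S\<in>\<T>. if on S V \<and> on S W then dist V W else 0) +
      (\<Sum>S\<in>\<T>. if on S W \<and> on S X then dist W X else 0) + (\<Sum>S\<in>\<T>. if on S X \<and> on S V then dist X V else 0))"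
    by (simp only: sum_distrib_left sum.distrib distrib_left)
  also have "\<dots> = t * (edge_count V W * dist V W + edge_count W X * dist W X + edge_count X V * dist X V)"
    by (simp only: edge_count_def count)
  finally show ?thesis .
qed

text \<open>The same side seen from \<open>E\<close>, with the same inward normal; facts about the
  corner \<open>P\<close> thereby become available at \<open>E\<close>.\<close>

lemma reversed: "tiling_side A B C \<T> h t (- u) n E P F"
proof -
  have "frame (- u) n"
    using frame_axioms by (simp add: frame_def)
  moreover have "P = E + dist E P *\<^sub>R (- u)"
    using E_eq[symmetric] by (simp add: dist_commute eq_diff_eq)
  moreover have "(F - E) \<bullet> n = (F - P) \<bullet> n"
    by (subst E_eq) (simp add: inner_diff_left inner_add_left)
  moreover have "{E, P, F} = {A, B, C}"
    using perm by blast
  ultimately show ?thesis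
    using F_pos similar_tiling_axioms
    by (simp add: tiling_side_def tiling_side_axioms_def)
qed

section \<open>Angles of tiles at points of a side\<close>

lemma ang_same_direction:
  assumes "0 < k"
  shows "ang P (P + k *\<^sub>R u) X = ang P E X"
proof -
  have "E - P = L *\<^sub>R u"
    using E_eq by (metis add_diff_cancel_left')
  then show ?thesis
    unfolding ang_def using assms L_pos by (simp add: dist_norm[of P "P + _"] norm_u)
qed

text \<open>One edge of the tile runs along the side and its third vertex lies in the big triangle,
  so \<open>ang_mono\<close> compares the two angles.\<close>

lemma ang_at_corner:
  assumes "S \<in> \<T>" "{V, W, X} = {A, B, C}" "h S V = P" "on S W"
  shows "ang V W X \<le> ang P E F"
proof -
  have mem: "V \<in> {A, B, C}" "W \<in> {A, B, C}" "X \<in> {A, B, C}"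
    using assms(2) by blast+
  have nc: "\<not> collinear {h S V, h S W, h S X}"
    by (rule tile_permuted(2)[OF assms(1,2)])
  then have ne: "h S W \<noteq> P" "h S X \<noteq> P"
    using assms(3) by (auto simp: insert_commute)
  have W: "h S W = P + pos (h S W) *\<^sub>R u"
    by (rule point_eq_if_height_0[OF assms(4)])
  then have "pos (h S W) \<noteq> 0"
    using ne(1) by (metis add.right_neutral scale_zero_left)
  then have "0 < pos (h S W)"
    using vertex_point(2)[OF assms(1) mem(2) assms(4)] by linarith
  have "ang V W X = ang P (h S W) (h S X)"
    using ang_tile[OF assms(1,2)] assms(3) by simp
  also have "\<dots> = ang P E (h S X)"
    using ang_same_direction[OF \<open>0 < pos (h S W)\<close>] W by metis
  also have "\<dots> \<le> ang P E F"
    using vertex_in_tile[OF assms(1) mem(3)] tile_subset[OF assms(1)] ne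
    by (intro ang_mono[OF PEF_noncollinear]) auto
  finally show ?thesis .
qed

lemma vertex_wedge:
  assumes "S \<in> \<T>" "{V, W, X} = {A, B, C}" "on S V" "on S W"
  shows "pos (h S V) < pos (h S W) \<Longrightarrow> wedge S (h S V) 0 (ang V W X)"
    and "pos (h S W) < pos (h S V) \<Longrightarrow> wedge S (h S V) (pi - ang V W X) pi"
proof -
  have mem: "V \<in> {A, B, C}" "W \<in> {A, B, C}" "X \<in> {A, B, C}"
    using assms(2) by blast+
  define p where "p = h S V"
  have "p \<in> S" "convex S"
    using vertex_in_tile[OF assms(1) mem(1)] tile_convex_closed[OF assms(1)] by (simp_all add: p_def)
  define d where "d = pos (h S W) - pos (h S V)"
  have W: "h S W = p + d *\<^sub>R u"
    unfolding p_def d_def by (rule line_shift[OF assms(3,4)])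
  have "0 < height (h S X)"
    using third_vertex_off[OF assms] vertex_point(1)[OF assms(1) mem(3)] by linarith
  then have htX: "0 < (h S X - p) \<bullet> n"
    using assms(3) by (simp add: p_def inner_diff_left)
  then obtain r \<theta> where r: "0 < r" "0 \<le> \<theta>" "\<theta> \<le> pi" "h S X - p = r *\<^sub>R e \<theta>"
    using polar[of "h S X - p"] by (metis inner_zero_left less_imp_le less_irrefl)
  then have "0 < r * sin \<theta>"
    using htX by simp
  then have "0 < sin \<theta>"
    using r(1) zero_less_mult_pos by blast
  then have "0 < \<theta>" "\<theta> < pi"
    using r by (auto simp: less_le)
  have X: "h S X = p + r *\<^sub>R e \<theta>"
    using r(4) by (metis add_diff_cancel_left' diff_add_cancel add.commute)
  have ang: "ang V W X = ang p (h S W) (h S X)"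
    using ang_tile[OF assms(1,2)] by (simp add: p_def)
  have inX: "\<exists>r>0. p + r *\<^sub>R e \<theta> \<in> S"
    using r(1) X vertex_in_tile[OF assms(1) mem(3)] by auto
  show "wedge S (h S V) 0 (ang V W X)" if "pos (h S V) < pos (h S W)"
  proof -
    have "0 < d"
      using that by (simp add: d_def)
    have \<theta>: "ang V W X = \<theta>"
      unfolding ang X W
      using ang_polar[of d r 0 \<theta> p] \<open>0 < d\<close> r by simp
    have "\<exists>r>0. p + r *\<^sub>R e 0 \<in> S"
      using W vertex_in_tile[OF assms(1) mem(2)] \<open>0 < d\<close> by (intro exI[of _ d]) simp
    moreover have "\<theta> < 0 + pi"
      using \<open>0 < \<theta>\<close> \<open>\<theta> < pi\<close> by simp
    ultimately show ?thesis
      unfolding \<theta> wedge_def p_def[symmetric] using inX \<open>0 < \<theta>\<close> \<open>\<theta> < pi\<close> \<open>p \<in> S\<close> \<open>convex S\<close> by blast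
  qed
  show "wedge S (h S V) (pi - ang V W X) pi" if "pos (h S W) < pos (h S V)"
  proof -
    have W': "h S W = p + (- d) *\<^sub>R e pi"
      using W by simp
    have "d < 0"
      using that by (simp add: d_def)
    have \<theta>: "pi - ang V W X = \<theta>"
      unfolding ang X W' ang_commute[of p "p + (- d) *\<^sub>R e pi"]
      using ang_polar[of r "- d" \<theta> pi p] \<open>d < 0\<close> r by simp
    have "\<exists>r>0. p + r *\<^sub>R e pi \<in> S"
      using W' vertex_in_tile[OF assms(1) mem(2)] \<open>d < 0\<close> by (intro exI[of _ "- d"]) simp
    moreover have "pi < \<theta> + pi"
      using \<open>0 < \<theta>\<close> \<open>\<theta> < pi\<close> by simp
    ultimately show ?thesis
      unfolding \<theta> wedge_def p_def[symmetric] using inX \<open>0 < \<theta>\<close> \<open>\<theta> < pi\<close> \<open>p \<in> S\<close> \<open>convex S\<close> by blast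
  qed
qed

text \<open>\<open>p\<close> may be a vertex of \<open>S\<close> or lie within an edge;
  \<open>triangle_dilation\<close> treats both alike. A small homothetic copy of \<open>S\<close>
  with a vertex at \<open>p\<close> lies inside \<open>S\<close>, which gives a wedge as wide as an
  angle of the tile, possibly narrower than the full angle of \<open>S\<close> at
  \<open>p\<close>.\<close>

lemma boundary_wedge:
  assumes "S \<in> \<T>" "p \<in> S" "height p = 0"
  obtains \<phi> \<psi> V W X where "{V, W, X} = {A, B, C}" "wedge S p \<phi> \<psi>" "0 \<le> \<phi>" "\<psi> \<le> pi" "\<psi> - \<phi> = ang V W X"
proof -
  have "p \<in> convex hull {h S A, h S B, h S C}"
    using assms tile by blast
  then obtain v w x \<epsilon> where vwx: "(v, w, x) \<in> {(h S A, h S B, h S C), (h S B, h S A, h S C), (h S C, h S A, h S B)}"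
    and \<epsilon>: "0 < \<epsilon>" "p + \<epsilon> *\<^sub>R (w - v) \<in> S" "p + \<epsilon> *\<^sub>R (x - v) \<in> S"
    using triangle_dilation[of p "h S A" "h S B" "h S C"] tile[OF assms(1)] by metis
  have "\<exists>V W X. {V, W, X} = {A, B, C} \<and> v = h S V \<and> w = h S W \<and> x = h S X"
  proof -
    have "{B, A, C} = {A, B, C}" "{C, A, B} = {A, B, C}"
      by blast+
    then show ?thesis
      using vwx by blast
  qed
  then obtain V W X where V: "{V, W, X} = {A, B, C}" "v = h S V" "w = h S W" "x = h S X"
    by blast
  have nc: "\<not> collinear {v, w, x}"
    using tile_permuted(2)[OF assms(1) V(1)] V by simp
  then have "w - v \<noteq> 0" "x - v \<noteq> 0"
    by (auto simp: insert_commute)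
  have ht: "0 \<le> (y - v) \<bullet> n" if "p + \<epsilon> *\<^sub>R (y - v) \<in> S" for y
  proof -
    have "0 \<le> height (p + \<epsilon> *\<^sub>R (y - v))"
      by (rule tile_point(1)[OF assms(1) that])
    also have "height (p + \<epsilon> *\<^sub>R (y - v)) = height p + \<epsilon> * ((y - v) \<bullet> n)"
      by (simp add: inner_add_left inner_diff_left algebra_simps)
    finally show ?thesis
      using assms(3) \<epsilon>(1) by (simp add: zero_le_mult_iff)
  qed
  obtain r1 \<theta>1 where r1: "0 < r1" "0 \<le> \<theta>1" "\<theta>1 \<le> pi" "w - v = r1 *\<^sub>R e \<theta>1"
    using polar[OF \<open>w - v \<noteq> 0\<close> ht[OF \<epsilon>(2)]] .
  obtain r2 \<theta>2 where r2: "0 < r2" "0 \<le> \<theta>2" "\<theta>2 \<le> pi" "x - v = r2 *\<^sub>R e \<theta>2"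
    using polar[OF \<open>x - v \<noteq> 0\<close> ht[OF \<epsilon>(3)]] .
  have w: "w = v + r1 *\<^sub>R e \<theta>1" and x: "x = v + r2 *\<^sub>R e \<theta>2"
    using r1(4) r2(4) by (metis add_diff_cancel_left' diff_add_cancel add.commute)+
  have in1: "\<exists>r>0. p + r *\<^sub>R e \<theta>1 \<in> S" and in2: "\<exists>r>0. p + r *\<^sub>R e \<theta>2 \<in> S"
    using \<epsilon> r1 r2 by (intro exI[of _ "\<epsilon> * r1"] exI[of _ "\<epsilon> * r2"]; simp)+
  have ang: "ang V W X = ang v w x"
    using ang_tile[OF assms(1) V(1)] V by simp
  have bounds: "0 < ang v w x" "ang v w x < pi"
    using ang_bounds[OF nc] by auto
  have cS: "convex S"
    using tile_convex_closed[OF assms(1)] by simp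
  show ?thesis
  proof (cases "\<theta>1 \<le> \<theta>2")
    case True
    then have "ang v w x = \<theta>2 - \<theta>1"
      unfolding w x using r1 r2 by (intro ang_polar) auto
    then show ?thesis
      using that[OF V(1), of \<theta>1 \<theta>2] bounds in1 in2 cS assms(2) r1 r2 ang unfolding wedge_def by simp
  next
    case False
    then have "ang v w x = \<theta>1 - \<theta>2"
      unfolding w x ang_commute[of v "v + r1 *\<^sub>R e \<theta>1"] using r1 r2 by (intro ang_polar) auto
    then show ?thesis
      using that[OF V(1), of \<theta>2 \<theta>1] bounds in1 in2 cS assms(2) r1 r2 ang unfolding wedge_def by simp
  qed
qed

text \<open>The ray to \<open>F\<close> cuts the straight angle at an inner point of the side into
  two wedges of \<open>D\<close>. The normal direction is inside one of them or is the direction of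
  \<open>F\<close> itself.\<close>

lemma normal_in_D:
  assumes "0 < k" "k < L"
  obtains \<epsilon> where "0 < \<epsilon>" "P + k *\<^sub>R u + \<epsilon> *\<^sub>R n \<in> D"
proof -
  define p where "p = P + k *\<^sub>R u"
  have "p \<in> D"
    using side_in_D assms by (simp add: p_def)
  have "(F - p) \<bullet> n = height F"
    by (simp add: p_def inner_diff_left inner_add_left)
  then have F: "0 < (F - p) \<bullet> n"
    using F_pos by simp
  then obtain r \<theta> where r: "0 < r" "0 \<le> \<theta>" "\<theta> \<le> pi" "F - p = r *\<^sub>R e \<theta>"
    using polar[of "F - p"] by (metis inner_zero_left less_imp_le less_irrefl)
  then have "0 < r * sin \<theta>"
    using F by simp
  then have "0 < sin \<theta>"
    using r(1) zero_less_mult_pos by blast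
  then have "0 < \<theta>" "\<theta> < pi"
    using r by (auto simp: less_le)
  have "F = p + r *\<^sub>R e \<theta>"
    using r(4) by (metis add_diff_cancel_left' diff_add_cancel add.commute)
  then have inF: "p + r *\<^sub>R e \<theta> \<in> D"
    by (metis hull_inc insertCI)
  have in0: "p + (L - k) *\<^sub>R e 0 \<in> D"
  proof -
    have "p + (L - k) *\<^sub>R e 0 = P + L *\<^sub>R u"
      by (simp add: p_def algebra_simps)
    then show ?thesis
      using side_in_D[of L] by simp
  qed
  have inpi: "p + k *\<^sub>R e pi \<in> D"
    by (simp add: p_def hull_inc)
  have "\<exists>\<epsilon>>0. p + \<epsilon> *\<^sub>R e (pi / 2) \<in> D"
  proof (cases "pi / 2" \<theta> rule: linorder_cases)
    case less
    have "wedge D p 0 \<theta>"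
      using inF in0 \<open>p \<in> D\<close> \<open>0 < \<theta>\<close> \<open>\<theta> < pi\<close> r(1) assms unfolding wedge_def
      by (intro conjI exI[of _ "L - k"] exI[of _ r]) auto
    then show ?thesis
      using wedge_interior[of D p 0 \<theta> "pi / 2"] less interior_subset by auto
  next
    case equal
    then show ?thesis
      using inF r(1) unfolding equal[symmetric] by blast
  next
    case greater
    have "wedge D p \<theta> pi"
      using inF inpi \<open>p \<in> D\<close> \<open>0 < \<theta>\<close> \<open>\<theta> < pi\<close> r(1) assms unfolding wedge_def
      by (intro conjI exI[of _ k] exI[of _ r]) auto
    then show ?thesis
      using wedge_interior[of D p \<theta> pi "pi / 2"] greater interior_subset by auto
  qed
  then show ?thesis
    using that by (auto simp: p_def)
qed

lemma ang_permuted: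
  assumes "{V, W, X} = {A, B, C}"
  shows "ang V W X \<in> {ang P E F, ang E P F, ang F P E}" "V = F \<Longrightarrow> ang V W X = ang F P E"
  using permE[OF assms] distinct by (auto simp: ang_commute)

text \<open>The angles of two tiles at \<open>F\<close> cannot occur side by side: what they leave free of the
  straight angle is positive but smaller than every angle of the tile.\<close>
lemma no_two_largest_angles:
  assumes S1: "S1 \<in> \<T>" "{F, W1, X1} = {A, B, C}" "on S1 F" "on S1 W1" "pos (h S1 W1) < pos (h S1 F)"
    and S2: "S2 \<in> \<T>" "{F, W2, X2} = {A, B, C}" "on S2 F" "on S2 W2" "pos (h S2 F) < pos (h S2 W2)"
    and "S1 \<noteq> S2" "h S1 F = h S2 F"
    and largest: "ang P E F < ang F P E" "ang E P F < ang F P E" and not_right: "ang F P E \<noteq> pi / 2"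
  shows False
proof -
  define p where "p = h S1 F"
  define \<gamma> where "\<gamma> = ang F P E"
  have \<gamma>1: "ang F W1 X1 = \<gamma>" and \<gamma>2: "ang F W2 X2 = \<gamma>"
    using ang_permuted(2)[OF S1(2)] ang_permuted(2)[OF S2(2)] by (simp_all add: \<gamma>_def)
  have w1: "wedge S1 p (pi - \<gamma>) pi"
    using vertex_wedge(2)[OF S1(1,2,3,4,5)] by (simp add: p_def \<gamma>1)
  have w2: "wedge S2 p 0 \<gamma>"
    using vertex_wedge(1)[OF S2(1,2,3,4,5)] assms(12) by (simp add: p_def \<gamma>2)
  have disj: "interior S \<inter> interior S' = {}" if "S \<in> \<T>" "S' \<in> \<T>" "S \<noteq> S'" for S S'
    using disjoint_interiors that by (auto simp: pairwise_def)
  have "\<gamma> \<le> pi - \<gamma> \<or> pi \<le> 0"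
    using wedges_disjoint[OF w2 w1 disj[OF S2(1) S1(1)]] \<open>S1 \<noteq> S2\<close> by blast
  then have "\<gamma> \<le> pi - \<gamma>"
    using pi_gt_zero by linarith
  then have "\<gamma> < pi / 2"
    using not_right by (simp add: \<gamma>_def)
  have sum: "ang P E F + ang E P F + \<gamma> = pi"
    using ang_sum[OF PEF_noncollinear] by (simp add: \<gamma>_def)
  have p: "height p = 0" "p = P + pos p *\<^sub>R u"
    using S1(3) point_eq_if_height_0[of p] by (simp_all add: p_def)
  have "0 < pos p" "pos p < L"
  proof -
    have "W1 \<in> {A, B, C}" "W2 \<in> {A, B, C}"
      using S1(2) S2(2) by blast+
    then have "0 \<le> pos (h S1 W1)" "pos (h S2 W2) \<le> L"
      using vertex_point(2)[OF S1(1) _ S1(4)] vertex_point(2)[OF S2(1) _ S2(4)] by blast+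
    then show "0 < pos p" "pos p < L"
      using S1(5) S2(5) assms(12) by (simp_all add: p_def)
  qed
  then obtain \<epsilon> where \<epsilon>: "0 < \<epsilon>" "p + \<epsilon> *\<^sub>R n \<in> D"
    using normal_in_D p(2) by metis
  \<comment> \<open>The tile that follows the normal from \<open>p\<close> fills part of the gap. It
    is neither \<open>S1\<close> nor \<open>S2\<close>: these would then contain an angle
    \<open>pi / 2\<close>, larger than \<open>\<gamma>\<close>, at their vertex
    \<open>F\<close>.\<close>
  have "\<exists>S\<in>\<T>. p \<in> S \<and> (\<exists>\<epsilon>>0. p + \<epsilon> *\<^sub>R n \<in> S)"
  proof (rule finite_closed_convex_cover_germ[OF finite_tiles _ \<epsilon>(1)])
    fix x
    assume "0 < x" "x < \<epsilon>"
    moreover have "p \<in> D"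
      using tile_subset[OF S1(1)] vertex_in_tile[OF S1(1) mem_vertices(3)] by (auto simp: p_def)
    ultimately show "p + x *\<^sub>R n \<in> \<Union>\<T>"
      using convex_germ[of D p \<epsilon> n x] \<epsilon>(2) Union_tiles perm by simp
  qed (use tile_convex_closed in blast)
  then obtain S \<delta> where S: "S \<in> \<T>" "p \<in> S" "0 < \<delta>" "p + \<delta> *\<^sub>R n \<in> S"
    by blast
  have n_out: "p + \<delta> *\<^sub>R n \<notin> S'"
    if "S' \<in> \<T>" "{F, W, X} = {A, B, C}" "h S' F = p" "h S' W = p + c *\<^sub>R e \<theta>" "0 < c"
      "\<theta> = 0 \<or> \<theta> = pi" for S' W X c \<theta>
  proof
    assume "p + \<delta> *\<^sub>R n \<in> S'"
    moreover have "n \<noteq> 0"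
      using norm_n by auto
    ultimately have "ang p (h S' W) (p + \<delta> *\<^sub>R n) \<le> ang p (h S' W) (h S' X)"
      using ang_mono[OF tile_permuted(2)[OF that(1,2)]] tile_permuted(1)[OF that(1,2)] that(3) \<open>0 < \<delta>\<close>
      by auto
    also have "ang p (h S' W) (h S' X) = \<gamma>"
      using ang_tile[OF that(1,2)] ang_permuted(2)[OF that(2)] that(3) by (simp add: \<gamma>_def)
    also have "ang p (h S' W) (p + \<delta> *\<^sub>R n) = pi / 2"
    proof (cases "\<theta> = 0")
      case True
      then show ?thesis
        using ang_polar[of c \<delta> 0 "pi / 2" p] that \<open>0 < \<delta>\<close> by simp
    next
      case False
      then have "ang p (p + \<delta> *\<^sub>R n) (h S' W) = pi / 2"
        using ang_polar[of \<delta> c "pi / 2" pi p] that \<open>0 < \<delta>\<close> by simp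
      then show ?thesis
        by (simp add: ang_commute)
    qed
    finally show False
      using \<open>\<gamma> < pi / 2\<close> by simp
  qed
  have "S \<noteq> S1"
  proof -
    have "h S1 W1 = p + (pos p - pos (h S1 W1)) *\<^sub>R e pi"
      by (subst line_shift[OF p(1) S1(4)]) (simp add: algebra_simps)
    then show ?thesis
      using n_out[OF S1(1,2) p_def[symmetric], of "pos p - pos (h S1 W1)" pi] S1(5) S(4)
      unfolding p_def by auto
  qed
  have "S \<noteq> S2"
  proof -
    have "h S2 W2 = p + (pos (h S2 W2) - pos p) *\<^sub>R e 0"
      using line_shift[OF p(1) S2(4)] by simp
    then show ?thesis
      using n_out[OF S2(1,2), of "pos (h S2 W2) - pos p" 0] S2(5) S(4) assms(12)
      unfolding p_def by auto
  qed
  obtain \<phi> \<psi> V W X where w: "{V, W, X} = {A, B, C}" "wedge S p \<phi> \<psi>" "0 \<le> \<phi>" "\<psi> \<le> pi" "\<psi> - \<phi> = ang V W X"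
    using boundary_wedge[OF S(1,2) p(1)] .
  have "\<phi> < \<psi>"
    using w(2) by (simp add: wedge_def)
  then have "\<gamma> \<le> \<phi>"
    using wedges_disjoint[OF w2 w(2) disj[OF S2(1) S(1)]] \<open>S \<noteq> S2\<close> w(3) by auto
  moreover have "\<psi> \<le> pi - \<gamma>"
    using wedges_disjoint[OF w1 w(2) disj[OF S1(1) S(1)]] \<open>S \<noteq> S1\<close> w(4) \<open>\<phi> < \<psi>\<close> by auto
  \<comment> \<open>The wedge of \<open>S\<close> lies between \<open>\<gamma>\<close> and
    \<open>pi - \<gamma>\<close>. By the angle sum its width is at most the sum of the two smaller
    angles minus \<open>\<gamma>\<close>, which is less than either of them.\<close>
  ultimately have "ang V W X + 2 * \<gamma> \<le> pi"
    using w(5) by linarith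
  moreover have "0 < ang P E F" "0 < ang E P F" "0 < \<gamma>"
    using ang_bounds(1)[OF PEF_noncollinear] ang_bounds(1)[of E P F] ang_bounds(1)[of F P E] PEF_noncollinear
    by (simp_all add: \<gamma>_def insert_commute)
  ultimately show False
    using ang_permuted(1)[OF w(1)] sum largest unfolding \<gamma>_def[symmetric] by auto
qed

text \<open>Asking for the tile that covers the side just beyond the point, rather than the point
  itself, excludes an edge that ends there.\<close>

lemma edge_starting_before:
  assumes "0 \<le> k" "k < L"
  obtains S V W X where "S \<in> \<T>" "{V, W, X} = {A, B, C}" "on S V" "on S W"
    "pos (h S V) \<le> k" "k < pos (h S W)"
proof -
  define p where "p = P + k *\<^sub>R u"
  have "\<exists>S\<in>\<T>. p \<in> S \<and> (\<exists>\<epsilon>>0. p + \<epsilon> *\<^sub>R u \<in> S)"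
  proof (rule finite_closed_convex_cover_germ[OF finite_tiles])
    show "0 < L - k"
      using assms by simp
    fix x
    assume "0 < x" "x < L - k"
    then have "P + (k + x) *\<^sub>R u \<in> D"
      using assms by (intro side_in_D) auto
    then show "p + x *\<^sub>R u \<in> \<Union>\<T>"
      using Union_tiles perm by (simp add: p_def scaleR_left_distrib add.assoc)
  qed (use tile_convex_closed in blast)
  then obtain S \<epsilon> where "S \<in> \<T>" "P + k *\<^sub>R u \<in> S" "0 < \<epsilon>" "P + (k + \<epsilon>) *\<^sub>R u \<in> S"
    by (auto simp: p_def scaleR_left_distrib add.assoc)
  moreover from this obtain V W X where "{V, W, X} = {A, B, C}" "on S V" "on S W"
      "pos (h S V) \<le> k" "k + \<epsilon> \<le> pos (h S W)"
    using two_vertices_on[of S k "k + \<epsilon>"] by auto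
  ultimately show ?thesis
    using that[of S V W X] by simp
qed

lemma corner_edge:
  obtains S V W X where "S \<in> \<T>" "{V, W, X} = {A, B, C}" "on S V" "on S W" "h S V = P" "0 < pos (h S W)"
    "ang V W X \<le> ang P E F"
proof -
  obtain S V W X where S: "S \<in> \<T>" "{V, W, X} = {A, B, C}" "on S V" "on S W" "pos (h S V) \<le> 0" "0 < pos (h S W)"
    using edge_starting_before[of 0] L_pos by blast
  have "V \<in> {A, B, C}"
    using S(2) by blast
  then have "pos (h S V) = 0"
    using vertex_point(2)[OF S(1) _ S(3)] S(5) by force
  then have "h S V = P"
    using point_eq_if_height_0[OF S(3)] by simp
  then show ?thesis
    using that[OF S(1-4) _ S(6)] ang_at_corner[OF S(1,2) _ S(4)] by blast
qed

text \<open>The tile at the corner has there an angle no larger than the smallest one, so its vertex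
  at the corner is the one labelled \<open>P\<close>. Both edges at that vertex are of the two kinds
  counted.\<close>

lemma smallest_angle_edge:
  assumes "ang P E F < ang E P F" "ang P E F < ang F P E"
  shows "edge_count P E \<noteq> 0 \<or> edge_count P F \<noteq> 0"
proof -
  obtain S V W X where S: "S \<in> \<T>" "{V, W, X} = {A, B, C}" "on S V" "on S W" "ang V W X \<le> ang P E F"
    using corner_edge by metis
  have "V = P"
    using permE[OF S(2)] S(5) assms distinct by (auto simp: ang_commute)
  then have "W = E \<or> W = F"
    using permE[OF S(2)] distinct by auto
  then show ?thesis
    using S finite_tiles \<open>V = P\<close> by (auto simp: edge_count_def card_eq_0_iff)
qed

text \<open>If the count were zero, each tile with an edge on the side would have its largest angle
  there. Walking from \<open>P\<close>, it always lies at the far end of the edge, since no two such angles meet;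
  but the last edge ends at \<open>E\<close>, where the angle is too small.\<close>
lemma largest_angle_edge:
  assumes largest: "ang P E F < ang F P E" "ang E P F < ang F P E" and not_right: "ang F P E \<noteq> pi / 2"
  shows "edge_count P E \<noteq> 0"
proof
  assume "edge_count P E = 0"
  then have no_PE: "\<not> (on S P \<and> on S E)" if "S \<in> \<T>" for S
    using that finite_tiles by (auto simp: edge_count_def)
  \<comment> \<open>The points where an edge coming from the direction of \<open>P\<close> ends with
    the largest angle. This finite set will turn out to be nonempty and without a maximum.\<close>
  define K where "K = {pos (h S F) |S. S \<in> \<T> \<and> on S F \<and>
    (\<exists>W X. {F, W, X} = {A, B, C} \<and> on S W \<and> pos (h S W) < pos (h S F))}"
  have "finite K"
    using finite_tiles by (rule finite_surj[of _ _ "\<lambda>S. pos (h S F)"]) (auto simp: K_def)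
  have F_edge: "V = F \<or> W = F"
    if "S \<in> \<T>" "{V, W, X} = {A, B, C}" "on S V" "on S W" for S V W X
    using permE[OF that(2)] no_PE[OF that(1)] that by auto
  have less_L: "k < L" if k: "k \<in> K" for k
  proof -
    obtain S W X where S: "S \<in> \<T>" "on S F" "k = pos (h S F)" "{F, W, X} = {A, B, C}" "on S W"
      using k unfolding K_def by blast
    \<comment> \<open>An edge ending at \<open>E\<close> would force the largest angle into the
      smaller angle of the big triangle there; \<open>ang_at_corner\<close> applies to the reversed
      side.\<close>
    have "k \<noteq> L"
    proof
      assume "k = L"
      interpret r: tiling_side A B C \<T> h t "- u" n E P F
        by (rule reversed)
      have "h S F = P + L *\<^sub>R u"
        using point_eq_if_height_0[OF S(2)] S(3) \<open>k = L\<close> by simp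
      then have "h S F = E"
        using E_eq by simp
      moreover have "(h S W - E) \<bullet> n = 0"
        using S(5) by (subst E_eq) (simp add: inner_diff_left inner_add_left)
      ultimately have "ang F W X \<le> ang E P F"
        using r.ang_at_corner[OF S(1,4)] by simp
      then show False
        using ang_permuted(2)[OF S(4)] largest by simp
    qed
    then show ?thesis
      using vertex_point(2)[OF S(1) mem_vertices(3) S(2)] S(3) by linarith
  qed
  \<comment> \<open>\<open>k = 0\<close> starts the walk at \<open>P\<close>. The edge covering the
    side beyond \<open>k\<close> has \<open>F\<close> at one end, and all the work goes into showing
    that this is the far end.\<close>
  have step: "\<exists>k'\<in>K. k < k'" if k: "k = 0 \<or> k \<in> K" for k
  proof -
    have "0 \<le> k"
      using k vertex_point(2)[OF _ mem_vertices(3)] by (auto simp: K_def)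
    moreover have "k < L"
      using k less_L L_pos by auto
    ultimately obtain S V W X where S: "S \<in> \<T>" "{V, W, X} = {A, B, C}" "on S V" "on S W"
        "pos (h S V) \<le> k" "k < pos (h S W)"
      by (rule edge_starting_before)
    have memV: "V \<in> {A, B, C}" "W \<in> {A, B, C}"
      using S(2) by blast+
    have "V \<noteq> F"
    proof
      assume "V = F"
      show False
      proof (cases "k \<in> K")
        case False
        then have "pos (h S V) = 0"
          using k S(5) vertex_point(2)[OF S(1) memV(1) S(3)] by force
        then have "h S V = P"
          using point_eq_if_height_0[OF S(3)] by simp
        then have "ang V W X \<le> ang P E F"
          using ang_at_corner[OF S(1,2) _ S(4)] by simp
        then show False
          using ang_permuted(2)[OF S(2) \<open>V = F\<close>] largest by simp
      next
        case True
        then obtain S1 W1 X1 where S1: "S1 \<in> \<T>" "{F, W1, X1} = {A, B, C}" "on S1 F" "on S1 W1"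
            "pos (h S1 W1) < pos (h S1 F)" and k1: "k = pos (h S1 F)"
          unfolding K_def by blast
        have trace: "P + x *\<^sub>R u \<in> S" if "pos (h S V) \<le> x" "x \<le> k" for x
        proof -
          have "x \<in> closed_segment (pos (h S V)) (pos (h S W))"
            using that S(6) by (simp add: closed_segment_eq_real_ivl)
          then show ?thesis
            using trace_eq_segment[OF S(1-4)] by blast
        qed
        have trace1: "P + x *\<^sub>R u \<in> S1" if "pos (h S1 W1) \<le> x" "x \<le> k" for x
        proof -
          have "x \<in> closed_segment (pos (h S1 F)) (pos (h S1 W1))"
            using that S1(5) k1 by (simp add: closed_segment_eq_real_ivl)
          then show ?thesis
            using trace_eq_segment[OF S1(1-4)] by blast
        qed
        \<comment> \<open>Either the edge of \<open>S\<close> starts at \<open>k\<close>, where two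
          largest angles then meet, or it starts earlier and overlaps that of \<open>S1\<close>. In
          the latter case \<open>S = S1\<close>, whose vertex \<open>F\<close> is at
          \<open>k\<close> and not earlier.\<close>
        show False
        proof (cases "pos (h S V) = k")
          case True
          \<comment> \<open>A tile with edges from \<open>F\<close> in both directions would have
            all three vertices on the side.\<close>
          have "S \<noteq> S1"
          proof
            assume "S = S1"
            then have "W1 \<noteq> W" "W1 \<noteq> F"
              using S(6) S1(5) k1 by auto
            then have "W1 = X"
              using S(2) S1(2) \<open>V = F\<close> by blast
            then show False
              using third_vertex_off[OF S(1-4)] S1(4) \<open>S = S1\<close> by simp
          qed
          moreover have "h S1 F = h S F"
            using point_eq_if_height_0[OF S(3)] point_eq_if_height_0[OF S1(3)] True k1 \<open>V = F\<close> by simp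
          ultimately show False
            using no_two_largest_angles[OF S1 S(1) _ _ S(4) _ _ _ largest not_right] S(2,3,6) True \<open>V = F\<close>
            by blast
        next
          case False
          define lo where "lo = max (pos (h S V)) (pos (h S1 W1))"
          have lo: "lo < k" "pos (h S V) \<le> lo" "pos (h S1 W1) \<le> lo"
            using False S(5) S1(5) k1 by (auto simp: lo_def)
          have "S = S1"
            using S(5) S1(5) k1 lo
            by (intro tile_eq_if_overlap_on_side[OF S(1) trace trace S1(1) trace1 trace1 lo(1)]) auto
          then show False
            using False k1 \<open>V = F\<close> by simp
        qed
      qed
    qed
    then have "W = F"
      using F_edge[OF S(1-4)] by simp
    then have "{F, V, X} = {A, B, C}"
      using S(2) by blast
    moreover have "pos (h S V) < pos (h S F)"
      using S(5,6) \<open>W = F\<close> by simp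
    ultimately have "pos (h S F) \<in> K"
      using S(1,3,4) \<open>W = F\<close> unfolding K_def by blast
    then show ?thesis
      using S(6) \<open>W = F\<close> by blast
  qed
  have "K \<noteq> {}"
    using step[of 0] by blast
  then obtain k where "k \<in> K" "\<And>k'. k' \<in> K \<Longrightarrow> k' \<le> k"
    using \<open>finite K\<close> by (metis Max_ge Max_in)
  then show False
    using step[of k] by force
qed

end

section \<open>Area and the matrix of edge counts\<close>

context similar_tiling
begin

text \<open>Heron's formula expresses the area by side lengths alone. All four factors under the
  root scale by \<open>t\<close>, so each tile has \<open>t\<^sup>2\<close> times the area of the
  big triangle.\<close>

lemma area_ratio: "real (card \<T>) * t\<^sup>2 = 1"
proof -
  let ?D = "convex hull {A, B, C}"
  have lm: "X \<in> lmeasurable" if "X = convex hull {a, b, c}" for X and a b c :: "real^2"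
    unfolding that by (intro lmeasurable_compact compact_convex_hull) simp
  have hull_content: "measure lebesgue (convex hull {a, b, c}) = measure lborel (convex hull {a, b, c})"
    for a b c :: "real^2"
    by (intro measure_completion) (simp add: borel_compact compact_convex_hull)
  have tile_area: "measure lebesgue S = t\<^sup>2 * measure lebesgue ?D" if "S \<in> \<T>" for S
  proof -
    define a b c where "a = dist B C" and "b = dist A C" and "c = dist A B"
    define s where "s = (a + b + c) / 2"
    have "measure lebesgue S = measure lebesgue (convex hull {h S A, h S B, h S C})"
      using tile[OF that] by simp
    also have "\<dots> = measure lborel (convex hull {h S A, h S B, h S C})"
      by (rule hull_content)
    also have "\<dots> = sqrt (t ^ 4 * (s * (s - a) * (s - b) * (s - c)))"
      unfolding heron using dist_tile[OF that]
      by (intro arg_cong[of _ _ sqrt]) (simp add: a_def b_def c_def s_def field_simps power4_eq_xxxx)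
    also have "\<dots> = t\<^sup>2 * sqrt (s * (s - a) * (s - b) * (s - c))"
      using real_sqrt_unique[of "t\<^sup>2" "t ^ 4"] by (simp add: real_sqrt_mult)
    also have "sqrt (s * (s - a) * (s - b) * (s - c)) = measure lborel ?D"
      unfolding heron by (simp add: a_def b_def c_def s_def)
    also have "measure lborel ?D = measure lebesgue ?D"
      by (rule hull_content[symmetric])
    finally show ?thesis .
  qed
  have "measure lebesgue ?D = measure lebesgue (\<Union>\<T>)"
    by (simp add: Union_tiles)
  also have "\<dots> = (\<Sum>S\<in>\<T>. measure lebesgue S)"
  proof (rule measure_negligible_finite_Union[OF finite_tiles])
    show "S \<in> lmeasurable" if "S \<in> \<T>" for S
      using lm tile[OF that] by blast
    show "pairwise (\<lambda>S S'. negligible (S \<inter> S')) \<T>"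
    proof (rule pairwiseI)
      fix S S'
      assume "S \<in> \<T>" "S' \<in> \<T>" "S \<noteq> S'"
      then have "interior S \<inter> interior S' = {}"
        using disjoint_interiors by (auto simp: pairwise_def)
      then have "interior (S \<inter> S') = {}" "convex (S \<inter> S')"
        using \<open>S \<in> \<T>\<close> \<open>S' \<in> \<T>\<close> tile_convex_closed by (auto simp: convex_Int)
      then show "negligible (S \<inter> S')"
        by (simp add: negligible_convex_interior)
    qed
  qed
  also have "\<dots> = real (card \<T>) * t\<^sup>2 * measure lebesgue ?D"
    using tile_area by simp
  finally have "measure lebesgue ?D = real (card \<T>) * t\<^sup>2 * measure lebesgue ?D" .
  moreover have "measure lebesgue ?D \<noteq> 0"
  proof -
    \<comment> \<open>The centroid is an interior point, so the area can be cancelled.\<close>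
    have "\<exists>x y z. 0 < x \<and> 0 < y \<and> 0 < z \<and> x + y + z = 1 \<and>
        x *\<^sub>R A + y *\<^sub>R B + z *\<^sub>R C = (1/3) *\<^sub>R A + (1/3) *\<^sub>R B + (1/3) *\<^sub>R C"
      by (rule exI[of _ "1/3"])+ simp
    then have "interior ?D \<noteq> {}"
      unfolding interior_convex_hull_3_minimal[OF noncollinear, simplified] by blast
    then show ?thesis
      using lm[OF refl] by (simp add: negligible_convex_interior flip: negligible_iff_measure0)
  qed
  ultimately show ?thesis
    by simp
qed

lemma obtain_side:
  assumes "{P, E, F} = {A, B, C}"
  obtains u n where "tiling_side A B C \<T> h t u n P E F"
proof -
  have "\<not> collinear {P, E, F}"
    using noncollinear assms by simp
  then obtain u n where "frame u n" "E = P + dist P E *\<^sub>R u" "0 < (F - P) \<bullet> n"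
    using obtain_frame by blast
  then have "tiling_side A B C \<T> h t u n P E F"
    using assms similar_tiling_axioms by (simp add: tiling_side_def tiling_side_axioms_def)
  then show ?thesis
    by (rule that)
qed

lemma card_square:
  assumes lt: "dist B C < dist A C" "dist A C < dist A B"
    and not_right: "\<not> orthogonal (A - C) (B - C)"
  shows "\<exists>k::nat. card \<T> = k\<^sup>2"
proof -
  define a b c where "a = dist B C" and "b = dist A C" and "c = dist A B"
  have perms: "{B, C, A} = {A, B, C}" "{A, C, B} = {A, B, C}" "{A, B, C} = {A, B, C}" "{C, A, B} = {A, B, C}"
    by blast+
  have nc: "\<not> collinear {B, C, A}" "\<not> collinear {C, A, B}"
    using noncollinear by (simp_all only: perms(1,4) not_False_eq_True)
  have angs: "ang A B C < ang B A C" "ang B C A < ang C B A"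
    using ang_less_if_side_less[OF noncollinear lt(1)] ang_less_if_side_less[OF nc(1)] lt(2)
    by (simp_all add: dist_commute)
  have less: "ang A B C < ang B A C" "ang B A C < ang C A B"
    using angs by (simp_all add: ang_commute)
  have "A \<noteq> C" "B \<noteq> C"
    using noncollinear by (auto simp: insert_commute)
  then have not_right': "ang C A B \<noteq> pi / 2"
    using not_right ang_eq_pi_half_imp_orthogonal by blast
  obtain u1 n1 where "tiling_side A B C \<T> h t u1 n1 B C A"
    using obtain_side[OF perms(1)] .
  then interpret s1: tiling_side A B C \<T> h t u1 n1 B C A .
  obtain u2 n2 where "tiling_side A B C \<T> h t u2 n2 A C B"
    using obtain_side[OF perms(2)] .
  then interpret s2: tiling_side A B C \<T> h t u2 n2 A C B .
  obtain u3 n3 where "tiling_side A B C \<T> h t u3 n3 A B C"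
    using obtain_side[OF perms(3)] .
  then interpret s3: tiling_side A B C \<T> h t u3 n3 A B C .
  \<comment> \<open>Rows are the sides \<open>B C\<close>, \<open>A C\<close>, \<open>A B\<close>
    and columns the kinds of tile edges in the same order, so that the three instances of
    \<open>side_length\<close> read \<open>M *v x = (1 / t) *\<^sub>R x\<close>.\<close>
  define M :: "real^3^3" where "M = vector
    [vector [s1.edge_count B C, s1.edge_count C A, s1.edge_count A B],
     vector [s2.edge_count B C, s2.edge_count C A, s2.edge_count A B],
     vector [s3.edge_count B C, s3.edge_count C A, s3.edge_count A B]]"
  define x :: "real^3" where "x = vector [a, b, c]"
  have M_entries: "\<exists>k::nat. M $ i $ j = real k" for i j
    using exhaust_3[of i] exhaust_3[of j] by (auto simp: M_def)
  have sqrt_t: "sqrt (real (card \<T>)) = 1 / t"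
  proof -
    have "real (card \<T>) = (1 / t)\<^sup>2"
      using area_ratio ratio_pos by (simp add: field_simps)
    then show ?thesis
      using ratio_pos by simp
  qed
  show ?thesis
  proof (rule side_matrix_square)
    show "M $ i $ j \<in> \<int>" "0 \<le> M $ i $ j" for i j
      using M_entries[of i j] by auto
    show "M *v x = sqrt (real (card \<T>)) *\<^sub>R x"
    proof -
      have row: "R = d / t" if "d = t * R" for d R
        using that ratio_pos by simp
      show ?thesis
        using row[OF s1.side_length[OF perms(1)]] row[OF s2.side_length[OF perms(1)]]
          row[OF s3.side_length[OF perms(1)]]
        unfolding vec_eq_iff forall_3 sqrt_t
        by (simp add: matrix_vector_mult_def sum_3 M_def x_def a_def b_def c_def dist_commute)
    qed
    show "0 < x $ i" for i
      using exhaust_3[of i] noncollinear \<open>A \<noteq> C\<close> \<open>B \<noteq> C\<close> by (auto simp: x_def a_def b_def c_def)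
    show "M $ 3 $ 3 \<noteq> 0"
      using s3.largest_angle_edge not_right' less by (simp add: M_def)
    show "M $ 2 $ 2 \<noteq> 0 \<or> M $ 2 $ 3 \<noteq> 0"
      using s2.smallest_angle_edge less s2.edge_count_commute[of A C] by (simp add: M_def ang_commute)
  qed
qed

end

section \<open>Similarity maps and the labelling of the tiles\<close>

lemma similarity_map_affine:
  assumes "similarity_map r f"
  obtains l d where "linear l" "f = (\<lambda>x. d + l x)"
proof -
  define l where "l x = f x - f 0" for x
  have "linear l"
    using assms by (intro scaling_linear[of l r]) (auto simp: l_def similarity_map_def dist_norm)
  then show ?thesis
    using that[of l "f 0"] by (simp add: l_def)
qed

lemma similarity_map_convex_hull:
  assumes "similarity_map r f"
  shows "f ` (convex hull X) = convex hull (f ` X)"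
proof -
  obtain l d where l: "linear l" "f = (\<lambda>x. d + l x)"
    using similarity_map_affine[OF assms] by blast
  have im: "f ` Y = (\<lambda>x. d + x) ` l ` Y" for Y
    by (simp add: l(2) image_image)
  show ?thesis
    unfolding im convex_hull_translation convex_hull_linear_image[OF l(1)] ..
qed

lemma similarity_map_bij:
  assumes "similarity_map r f"
  shows "bij f"
proof -
  obtain l d where l: "linear l" "f = (\<lambda>x. d + l x)"
    using similarity_map_affine[OF assms] by blast
  have "inj f"
    using assms unfolding inj_def similarity_map_def
    by (metis dist_eq_0_iff less_irrefl mult_eq_0_iff)
  then have "inj l"
    by (simp add: l(2) inj_def)
  then have "surj l"
    using l(1) linear_injective_imp_surjective by blast
  have "y \<in> range f" for y
  proof -
    obtain x where "l x = y - d"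
      using \<open>surj l\<close> by (metis surjD)
    then have "y = f x"
      by (simp add: l(2))
    then show ?thesis
      by blast
  qed
  then show ?thesis
    using \<open>inj f\<close> by (auto simp: bij_def)
qed

lemma similarity_map_inv:
  assumes "similarity_map r f"
  shows "similarity_map (1 / r) (inv f)"
proof -
  have "r * dist (inv f x) (inv f y) = dist x y" for x y
    using assms surj_f_inv_f[OF bij_is_surj[OF similarity_map_bij[OF assms]]]
    unfolding similarity_map_def by metis
  then show ?thesis
    using assms by (simp add: similarity_map_def field_simps)
qed

lemma similarity_map_compose:
  assumes "similarity_map r f" "similarity_map q g"
  shows "similarity_map (q * r) (g \<circ> f)"
  using assms by (simp add: similarity_map_def mult.assoc)

lemma collinear_convex_hull:
  assumes "collinear X"
  shows "collinear (convex hull X)"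
  using assms unfolding collinear_affine_hull by (meson affine_imp_convex affine_affine_hull hull_minimal)

text \<open>Each tile is an image of \<open>T\<close>, and \<open>T\<close> is an image of the big
  triangle. The composed similarity has ratio \<open>1 / r\<close>, and its values at
  \<open>A\<close>, \<open>B\<close>, \<open>C\<close> name the vertices of the tile.\<close>

lemma obtain_similar_tiling:
  assumes "\<not> collinear {A, B, C}" "similar_figures T (convex hull {A, B, C})"
    and "tiling N (convex hull {A, B, C}) T \<T>"
  obtains h t where "similar_tiling A B C \<T> h t"
proof -
  obtain r f where f: "similarity_map r f" "f ` T = convex hull {A, B, C}"
    using assms(2) by (auto simp: similar_figures_def)
  have T: "T = inv f ` (convex hull {A, B, C})"
    using similarity_map_bij[OF f(1)] f(2) by (metis bij_is_inj image_inv_f_f)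
  have "\<forall>S\<in>\<T>. \<exists>g. similarity_map 1 g \<and> g ` T = S"
    using assms(3) by (auto simp: tiling_def congruent_figures_def)
  then obtain g where g: "\<And>S. S \<in> \<T> \<Longrightarrow> similarity_map 1 (g S)" "\<And>S. S \<in> \<T> \<Longrightarrow> g S ` T = S"
    by metis
  define h where "h S = g S \<circ> inv f" for S
  have h: "similarity_map (1 / r) (h S)" if "S \<in> \<T>" for S
    using similarity_map_compose[OF similarity_map_inv[OF f(1)] g(1)[OF that]] by (simp add: h_def)
  have tile: "S = convex hull {h S A, h S B, h S C}" if "S \<in> \<T>" for S
  proof -
    have "S = h S ` (convex hull {A, B, C})"
      using g(2)[OF that] T by (simp add: h_def image_comp)
    then show ?thesis
      using similarity_map_convex_hull[OF h[OF that]] by simp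
  qed
  have "similar_tiling A B C \<T> h (1 / r)"
  proof
    show "finite \<T>" "pairwise (\<lambda>S S'. interior S \<inter> interior S' = {}) \<T>" "\<Union>\<T> = convex hull {A, B, C}"
      using assms(3) by (auto simp: tiling_def)
    show "0 < 1 / r"
      using f(1) by (simp add: similarity_map_def)
    fix S
    assume S: "S \<in> \<T>"
    show "S = convex hull {h S A, h S B, h S C}"
      by (rule tile[OF S])
    show "dist (h S V) (h S W) = 1 / r * dist V W" for V W
      using h[OF S] by (simp add: similarity_map_def)
    \<comment> \<open>These vertices are not known to be the values of \<open>h S\<close>. But if
      those values were collinear, so would be their hull, which contains \<open>a\<close>,
      \<open>b\<close>, \<open>c\<close>.\<close>
    obtain a b c where "\<not> collinear {a, b, c}" "S = convex hull {a, b, c}"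
      using assms(3) S by (auto simp: tiling_def closed_triangle_def)
    then show "\<not> collinear {h S A, h S B, h S C}"
      using collinear_convex_hull tile[OF S] by (metis collinear_subset hull_subset)
  qed (use assms(1) in auto)
  then show ?thesis
    by (rule that)
qed

theorem theorem9:
  fixes A B C :: "real^2" and T :: "(real^2) set" and N :: nat
  assumes "\<not> collinear {A, B, C}"
    and "\<not> right_triangle A B C"
    and "\<not> isosceles_triangle A B C"
    and "closed_triangle T"
    and "similar_figures T (convex hull {A, B, C})"
    and "can_be_tiled N (convex hull {A, B, C}) T"
  shows "\<exists>k::nat. N = k\<^sup>2"
proof -
  obtain \<T> where \<T>: "tiling N (convex hull {A, B, C}) T \<T>"
    using assms(6) by (auto simp: can_be_tiled_def)
  \<comment> \<open>One tiling serves every naming of the vertices, since the big triangle is the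
    same set. \<open>R\<close> is opposite the longest side, and its angle is the one that must not
    be right.\<close>
  have sorted: ?thesis
    if P: "{P, Q, R} = {A, B, C}" and "dist Q R < dist P R" "dist P R < dist P Q"
      and "\<not> orthogonal (P - R) (Q - R)" for P Q R
  proof -
    obtain h t where "similar_tiling P Q R \<T> h t"
      using obtain_similar_tiling[of P Q R T N \<T>] assms(1,5) \<T> unfolding P by blast
    then show ?thesis
      using similar_tiling.card_square that(2-4) \<T> unfolding tiling_def by blast
  qed
  have orth: "\<not> orthogonal (B - A) (C - A)" "\<not> orthogonal (A - B) (C - B)" "\<not> orthogonal (A - C) (B - C)"
    using assms(1,2) by (auto simp: right_triangle_def)
  have "dist A B \<noteq> dist A C" "dist A B \<noteq> dist B C" "dist A C \<noteq> dist B C"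
    using assms(1,3) by (auto simp: isosceles_triangle_def dist_commute)
  then consider "dist B C < dist A C" "dist A C < dist A B" | "dist B C < dist A B" "dist A B < dist A C"
    | "dist A C < dist B C" "dist B C < dist A B" | "dist A C < dist A B" "dist A B < dist B C"
    | "dist A B < dist B C" "dist B C < dist A C" | "dist A B < dist A C" "dist A C < dist B C"
    by linarith
  then show ?thesis
  proof cases
    case 1
    then show ?thesis
      using sorted[of A B C] orth by simp
  next
    case 2
    then show ?thesis
      using sorted[of A C B] orth by (simp add: dist_commute insert_commute)
  next
    case 3
    then show ?thesis
      using sorted[of B A C] orth by (simp add: dist_commute insert_commute orthogonal_commute)
  next
    case 4
    then show ?thesis
      using sorted[of B C A] orth by (simp add: dist_commute insert_commute orthogonal_commute)
  next
    case 5
    then show ?thesis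
      using sorted[of C A B] orth by (simp add: dist_commute insert_commute orthogonal_commute)
  next
    case 6
    then show ?thesis
      using sorted[of C B A] orth by (simp add: dist_commute insert_commute orthogonal_commute)
  qed
qed

end
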